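(* Let $\Bbbk=(\Bbbk_\alpha)_{\alpha\in\mathrm{ON}}$ be an ordinal-indexed tower of fields with $\Bbbk_\alpha\subset\Bbbk_\beta$ of infinite degree whenever $\alpha<\beta$, and let $\mathcal{C}_{\Bbbk}$ be the associated category of grounded chains. An object $V$ of $\mathcal{C}_{\Bbbk}$ is injective in $\mathcal{C}_{\Bbbk}$ if and only if there is an ordinal $\alpha$ such that $V$ belongs to $\mathcal{C}_{\Bbbk}|_{\alpha}$ and is injective in the (Grothendieck) category $\mathcal{C}_{\Bbbk}|_{\alpha}$.
   Context: Set theory: ZFC (with proper classes treated in the metatheory) or NBG with choice. $\mathrm{ON}$ is the (large) well-ordered class of ordinals. The tower is a functor $\alpha\mapsto\Bbbk_\alpha$ from $(\mathrm{ON},\le)$ to fields, its maps viewed as inclusions $\Bbbk_\alpha\subset\Bbbk_\beta$ for $\alpha\le\beta$, with $\Bbbk_\beta$ of infinite degree over $\Bbbk_\alpha$ whenever $\alpha<\beta$. Let $\overline{\mathcal{C}}_{\Bbbk}$ have as objects families $V=(V_\alpha)_{\alpha\in\mathrm{ON}}$ of $\Bbbk_\alpha$-vector spaces with $\Bbbk_\alpha$-linear maps $\nu_{\beta\alpha}:V_\alpha\to V_\beta$ for $\alpha\le\beta$, satisfying $\nu_{\alpha\alpha}=\mathrm{id}$ and $\nu_{\gamma\beta}\nu_{\beta\alpha}=\nu_{\gamma\alpha}$; morphisms are families of $\Bbbk_\alpha$-linear maps $V_\alpha\to W_\alpha$ commuting with the $\nu$'s. An object is $\alpha$-grounded if for all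 $\beta>\alpha$, $V_\beta$ is the $\Bbbk_\beta$-span of $\nu_{\beta\alpha}(V_\alpha)$; it is grounded if it is $\alpha$-grounded for some ordinal $\alpha$. $\mathcal{C}_{\Bbbk}$ is the full subcategory of $\overline{\mathcal{C}}_{\Bbbk}$ on the grounded objects; it is abelian. For an ordinal $\alpha$, $\mathcal{C}_{\Bbbk}|_{\alpha}$ is the full subcategory of $\mathcal{C}_{\Bbbk}$ on the objects $(V_\beta)_\beta$ with $V_\beta=\{0\}$ for all $\beta\ge\alpha$. *)

theory Defs
  imports "HOL-Algebra.Module" "HOL-Algebra.Embedded_Algebras"
begin

section \<open>The set-theoretic universe\<close>

text \<open>
  A type of this class is a universe of sets in the sense of ZF with proper classes: its elements
  are the sets, and the HOL sets over it are the classes, those in the range of \<open>elts\<close>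
  being the classes that are sets.  Choice, also for classes, is inherited from HOL.
  HOL itself cannot exhibit an instance (its existence amounts to that of an inaccessible
  cardinal), so the class plays the role of the ambient set theory.
\<close>

class zfc_universe =
  fixes elts :: "'a \<Rightarrow> 'a set"
  assumes extensionality: "elts x = elts y \<Longrightarrow> x = y"
    and foundation: "wf {(x, y). x \<in> elts y}"
    and separation: "A \<subseteq> elts x \<Longrightarrow> \<exists>z. elts z = A"
    and pairing: "\<exists>z. elts z = {x, y}"
    and union: "\<exists>z. elts z = (\<Union>y\<in>elts x. elts y)"
    and power_set: "\<exists>z. elts z = {y. elts y \<subseteq> elts x}"
    and replacement: "\<exists>z. elts z = f ` elts x"
    and infinity: "\<exists>z. infinite (elts z)"

definition is_a_set :: "'v::zfc_universe set \<Rightarrow> bool"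
  where "is_a_set A \<longleftrightarrow> A \<in> range elts"

text \<open>Von Neumann ordinals; \<open>ON\<close> is a proper class.\<close>

definition transitive_set :: "'v::zfc_universe \<Rightarrow> bool"
  where "transitive_set x \<longleftrightarrow> (\<forall>y\<in>elts x. elts y \<subseteq> elts x)"

definition ON :: "'v::zfc_universe set"
  where "ON = {\<alpha>. transitive_set \<alpha> \<and> (\<forall>\<beta>\<in>elts \<alpha>. transitive_set \<beta>)}"

definition ord_less :: "'v::zfc_universe \<Rightarrow> 'v \<Rightarrow> bool"  (infix \<open>\<prec>\<close> 50)
  where "\<alpha> \<prec> \<beta> \<longleftrightarrow> \<alpha> \<in> ON \<and> \<beta> \<in> ON \<and> \<alpha> \<in> elts \<beta>"

definition ord_le :: "'v::zfc_universe \<Rightarrow> 'v \<Rightarrow> bool"  (infix \<open>\<preceq>\<close> 50)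
  where "\<alpha> \<preceq> \<beta> \<longleftrightarrow> \<alpha> \<in> ON \<and> \<beta> \<in> ON \<and> (\<alpha> \<in> elts \<beta> \<or> \<alpha> = \<beta>)"


section \<open>Linear algebra\<close>

definition linear_maps ::
    "('k, 'm) ring_scheme \<Rightarrow> ('k, 'a, 'p) module_scheme \<Rightarrow> ('k, 'b, 'q) module_scheme \<Rightarrow> ('a \<Rightarrow> 'b) set"
  where "linear_maps R M N =
    {f \<in> carrier M \<rightarrow> carrier N.
      (\<forall>x\<in>carrier M. \<forall>y\<in>carrier M. f (x \<oplus>\<^bsub>M\<^esub> y) = f x \<oplus>\<^bsub>N\<^esub> f y) \<and>
      (\<forall>a\<in>carrier R. \<forall>x\<in>carrier M. f (a \<odot>\<^bsub>M\<^esub> x) = a \<odot>\<^bsub>N\<^esub> f x)}"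

definition restrict_scalars :: "('k \<Rightarrow> 'l) \<Rightarrow> ('l, 'a) module \<Rightarrow> ('k, 'a) module"
  where "restrict_scalars \<phi> M =
    \<lparr>carrier = carrier M, mult = mult M, one = one M, zero = zero M, add = add M,
     smult = (\<lambda>a x. \<phi> a \<odot>\<^bsub>M\<^esub> x)\<rparr>"

definition linear_span :: "('k, 'm) ring_scheme \<Rightarrow> ('k, 'a) module \<Rightarrow> 'a set \<Rightarrow> 'a set"
  where "linear_span R M S = \<Inter> {H. submodule H R M \<and> S \<subseteq> H}"


section \<open>Towers of fields and chains of vector spaces\<close>

text \<open>
  In both records the values at arguments outside \<open>ON\<close> are irrelevant.  As with
  \<open>\<nu>\<^sub>\<beta>\<^sub>\<alpha> : V\<^sub>\<alpha> \<rightarrow> V\<^sub>\<beta>\<close>, the first argument of a transition map is the target index.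
\<close>

record 'v tower =
  fld :: "'v \<Rightarrow> 'v ring"
  emb :: "'v \<Rightarrow> 'v \<Rightarrow> 'v \<Rightarrow> 'v"

record 'v chain =
  space :: "'v \<Rightarrow> ('v, 'v) module"
  tmap :: "'v \<Rightarrow> 'v \<Rightarrow> 'v \<Rightarrow> 'v"

definition field_tower :: "'v::zfc_universe tower \<Rightarrow> bool"
  where "field_tower k \<longleftrightarrow>
    (\<forall>\<alpha>\<in>ON. field (fld k \<alpha>) \<and> is_a_set (carrier (fld k \<alpha>))) \<and>
    (\<forall>\<alpha> \<beta>. \<alpha> \<preceq> \<beta> \<longrightarrow> emb k \<beta> \<alpha> \<in> ring_hom (fld k \<alpha>) (fld k \<beta>)) \<and>
    (\<forall>\<alpha>\<in>ON. \<forall>a\<in>carrier (fld k \<alpha>). emb k \<alpha> \<alpha> a = a) \<and>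
    (\<forall>\<alpha> \<beta> \<gamma>. \<alpha> \<preceq> \<beta> \<and> \<beta> \<preceq> \<gamma> \<longrightarrow>
      (\<forall>a\<in>carrier (fld k \<alpha>). emb k \<gamma> \<beta> (emb k \<beta> \<alpha> a) = emb k \<gamma> \<alpha> a))"

definition infinite_degree_tower :: "'v::zfc_universe tower \<Rightarrow> bool"
  where "infinite_degree_tower k \<longleftrightarrow> field_tower k \<and>
    (\<forall>\<alpha> \<beta>. \<alpha> \<prec> \<beta> \<longrightarrow>
      ring.infinite_dimension (fld k \<beta>) (emb k \<beta> \<alpha> ` carrier (fld k \<alpha>)) (carrier (fld k \<beta>)))"

definition chain_obj :: "'v::zfc_universe tower \<Rightarrow> 'v chain \<Rightarrow> bool"
  where "chain_obj k V \<longleftrightarrow>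
    (\<forall>\<alpha>\<in>ON. module (fld k \<alpha>) (space V \<alpha>) \<and> is_a_set (carrier (space V \<alpha>))) \<and>
    (\<forall>\<alpha> \<beta>. \<alpha> \<preceq> \<beta> \<longrightarrow>
      tmap V \<beta> \<alpha> \<in> linear_maps (fld k \<alpha>) (space V \<alpha>) (restrict_scalars (emb k \<beta> \<alpha>) (space V \<beta>))) \<and>
    (\<forall>\<alpha>\<in>ON. \<forall>x\<in>carrier (space V \<alpha>). tmap V \<alpha> \<alpha> x = x) \<and>
    (\<forall>\<alpha> \<beta> \<gamma>. \<alpha> \<preceq> \<beta> \<and> \<beta> \<preceq> \<gamma> \<longrightarrow>
      (\<forall>x\<in>carrier (space V \<alpha>). tmap V \<gamma> \<beta> (tmap V \<beta> \<alpha> x) = tmap V \<gamma> \<alpha> x))"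

definition chain_hom :: "'v::zfc_universe tower \<Rightarrow> 'v chain \<Rightarrow> 'v chain \<Rightarrow> ('v \<Rightarrow> 'v \<Rightarrow> 'v) set"
  where "chain_hom k V W = {f.
    (\<forall>\<alpha>\<in>ON. f \<alpha> \<in> linear_maps (fld k \<alpha>) (space V \<alpha>) (space W \<alpha>)) \<and>
    (\<forall>\<alpha> \<beta>. \<alpha> \<preceq> \<beta> \<longrightarrow>
      (\<forall>x\<in>carrier (space V \<alpha>). f \<beta> (tmap V \<beta> \<alpha> x) = tmap W \<beta> \<alpha> (f \<alpha> x)))}"

text \<open>
  HOL functions are total, so equality of morphisms out of \<open>V\<close> is agreement on the carriers
  of the spaces of \<open>V\<close>.
\<close>

definition chain_hom_eq :: "'v::zfc_universe chain \<Rightarrow> ('v \<Rightarrow> 'v \<Rightarrow> 'v) \<Rightarrow> ('v \<Rightarrow> 'v \<Rightarrow> 'v) \<Rightarrow> bool"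
  where "chain_hom_eq V f g \<longleftrightarrow> (\<forall>\<alpha>\<in>ON. \<forall>x\<in>carrier (space V \<alpha>). f \<alpha> x = g \<alpha> x)"

definition chain_comp :: "('v \<Rightarrow> 'v \<Rightarrow> 'v) \<Rightarrow> ('v \<Rightarrow> 'v \<Rightarrow> 'v) \<Rightarrow> 'v \<Rightarrow> 'v \<Rightarrow> 'v"
  where "chain_comp g f = (\<lambda>\<alpha>. g \<alpha> \<circ> f \<alpha>)"

definition grounded_at :: "'v::zfc_universe tower \<Rightarrow> 'v \<Rightarrow> 'v chain \<Rightarrow> bool"
  where "grounded_at k \<alpha> V \<longleftrightarrow>
    (\<forall>\<beta>. \<alpha> \<prec> \<beta> \<longrightarrow>
      carrier (space V \<beta>) =
        linear_span (fld k \<beta>) (space V \<beta>) (tmap V \<beta> \<alpha> ` carrier (space V \<alpha>)))"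

text \<open>Full subcategories of the category of all chains are given by their classes of objects.\<close>

definition grounded_chains :: "'v::zfc_universe tower \<Rightarrow> 'v chain set"
  where "grounded_chains k = {V. chain_obj k V \<and> (\<exists>\<alpha>\<in>ON. grounded_at k \<alpha> V)}"

definition grounded_chains_below :: "'v::zfc_universe tower \<Rightarrow> 'v \<Rightarrow> 'v chain set"
  where "grounded_chains_below k \<alpha> =
    {V \<in> grounded_chains k. \<forall>\<beta>. \<alpha> \<preceq> \<beta> \<longrightarrow> carrier (space V \<beta>) = {\<zero>\<^bsub>space V \<beta>\<^esub>}}"


section \<open>Injective objects of a full subcategory\<close>

definition monomorphism_in ::
    "'v::zfc_universe tower \<Rightarrow> 'v chain set \<Rightarrow> 'v chain \<Rightarrow> 'v chain \<Rightarrow> ('v \<Rightarrow> 'v \<Rightarrow> 'v) \<Rightarrow> bool"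
  where "monomorphism_in k \<C> A B m \<longleftrightarrow> m \<in> chain_hom k A B \<and>
    (\<forall>Z\<in>\<C>. \<forall>g\<in>chain_hom k Z A. \<forall>h\<in>chain_hom k Z A.
      chain_hom_eq Z (chain_comp m g) (chain_comp m h) \<longrightarrow> chain_hom_eq Z g h)"

definition injective_in :: "'v::zfc_universe tower \<Rightarrow> 'v chain set \<Rightarrow> 'v chain \<Rightarrow> bool"
  where "injective_in k \<C> V \<longleftrightarrow> V \<in> \<C> \<and>
    (\<forall>A\<in>\<C>. \<forall>B\<in>\<C>. \<forall>m. monomorphism_in k \<C> A B m \<longrightarrow>
      (\<forall>f\<in>chain_hom k A V. \<exists>g\<in>chain_hom k B V. chain_hom_eq A (chain_comp g m) f))"

end

(*
  An injective V has surjective transition maps, because a map from the free chain on a generator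
  of degree beta extends to the free chain on a generator of degree alpha <= beta.  If V is
  grounded at alpha and does not vanish from some ordinal on, then every field k_beta embeds
  in a quotient of the set V_alpha, and the strictly increasing subfields k_delta of k_beta give
  strict chains of subsets of V_alpha of every ordinal length, contradicting Burali-Forti.
  Conversely, and for comparing injectivity in the two categories, truncation at alpha is exact and
  left adjoint to the inclusion of the chains vanishing from alpha on.
*)
theory Submission
  imports Defs
begin

section \<open>Ordinals\<close>

text \<open>Instead of counting cardinals, the contradiction rests on an order-theoretic fact: a
  strict chain of subsets indexed by the ordinals up to \<beta> remembers \<beta>. Sending \<beta>
  to the range of its chain would thus inject a proper class of ordinals into the double power set
  of \<open>V\<^sub>\<alpha>\<close>. Infinite degree enters as strictness of these chains;
  preimages under the surjective transition maps keep them all in one set independent of \<beta>.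

  The other obstacle is that monomorphisms are defined by cancellation against the objects of the
  category at hand, so the notion itself must be compared between the two categories. Free chains
  probe single elements and turn cancellation among grounded chains into injectivity in every
  degree, which survives truncation. In the opposite direction, maps into a chain vanishing from
  \<alpha> on factor through the truncation of their source, so truncated test objects
  suffice.\<close>

lemma is_a_setI: "elts x = A \<Longrightarrow> is_a_set A"
  by (auto simp: is_a_set_def)

lemma is_a_setE:
  assumes "is_a_set A"
  obtains x where "A = elts x"
  using assms by (auto simp: is_a_set_def)

lemma is_a_set_subset:
  assumes "is_a_set A" "B \<subseteq> A"
  shows "is_a_set B"
proof -
  obtain x where "A = elts x"
    using assms(1) by (rule is_a_setE)
  then obtain z where "elts z = B"
    using separation[of B x] assms(2) by blast
  then show ?thesis
    by (rule is_a_setI)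
qed

lemma is_a_set_image:
  fixes f :: "'v::zfc_universe \<Rightarrow> 'v"
  assumes "is_a_set A"
  shows "is_a_set (f ` A)"
proof -
  obtain x where "A = elts x"
    using assms by (rule is_a_setE)
  then obtain z where "elts z = f ` A"
    using replacement[of f x] by blast
  then show ?thesis
    by (rule is_a_setI)
qed

lemma is_a_set_singleton: "is_a_set {x}"
proof -
  obtain z where "elts z = {x, x}"
    using pairing by blast
  then show ?thesis
    by (intro is_a_setI) simp
qed

lemma is_a_set_Union:
  assumes "is_a_set A"
  shows "is_a_set (\<Union>y\<in>A. elts y)"
proof -
  obtain x where "A = elts x"
    using assms by (rule is_a_setE)
  then obtain z where "elts z = (\<Union>y\<in>A. elts y)"
    using union[of x] by blast
  then show ?thesis
    by (rule is_a_setI)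
qed

lemma is_a_set_Un:
  assumes "is_a_set A" "is_a_set B"
  shows "is_a_set (A \<union> B)"
proof -
  obtain x y where xy: "A = elts x" "B = elts y"
    using assms by (auto simp: is_a_set_def)
  obtain z where "elts z = {x, y}"
    using pairing by blast
  then have "is_a_set {x, y}"
    by (rule is_a_setI)
  from is_a_set_Union[OF this] show ?thesis
    by (simp add: xy)
qed

text \<open>The function \<open>inv_into UNIV elts\<close> picks the element of the universe that
  codes a given set, so that families of sets can in turn be treated as sets.\<close>

lemma elts_inv_elts: "is_a_set A \<Longrightarrow> elts (inv_into UNIV elts A) = A"
  by (simp add: is_a_set_def f_inv_into_f)

text \<open>By separation every subset of a set is a set, so its code is an element of the power set
  supplied by the axiom. Codes are used because \<open>Pow A\<close> itself has a higher type than
  the classes to which \<open>is_a_set\<close> applies.\<close>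

lemma is_a_set_Pow:
  assumes "is_a_set A"
  shows "is_a_set (inv_into UNIV elts ` Pow A)"
proof -
  obtain x where x: "A = elts x"
    using assms by (auto simp: is_a_set_def)
  obtain z where z: "elts z = {y. elts y \<subseteq> elts x}"
    using power_set by blast
  have "inv_into UNIV elts ` Pow A \<subseteq> elts z"
  proof (rule image_subsetI)
    fix B assume "B \<in> Pow A"
    then show "inv_into UNIV elts B \<in> elts z"
      using elts_inv_elts[OF is_a_set_subset[OF assms, of B]] by (simp add: x z)
  qed
  moreover have "is_a_set (elts z)"
    by (simp add: is_a_set_def)
  ultimately show ?thesis
    by (rule is_a_set_subset[rotated])
qed

text \<open>Replacement along the inverse function: \<open>A\<close> is the image of a subset of
  \<open>B\<close>. This is how an injection of ordinals into a set will contradict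
  Burali-Forti.\<close>

lemma is_a_set_inj_on:
  fixes f :: "'v::zfc_universe \<Rightarrow> 'v"
  assumes "inj_on f A" "f ` A \<subseteq> B" "is_a_set B"
  shows "is_a_set A"
  using is_a_set_image[OF is_a_set_subset[OF assms(3,2)], of "inv_into A f"] assms(1)
  by (simp add: inv_into_image_cancel)

section \<open>Linearity of the ordinals and Burali-Forti\<close>

lemma elts_irrefl: "x \<notin> elts x"
  using wf_not_refl[OF foundation, of x] by simp

lemma ON_elts: "\<alpha> \<in> ON \<Longrightarrow> \<beta> \<in> elts \<alpha> \<Longrightarrow> \<beta> \<in> ON"
  unfolding ON_def transitive_set_def by blast

lemma ON_trans: "\<alpha> \<in> ON \<Longrightarrow> \<beta> \<in> elts \<alpha> \<Longrightarrow> \<gamma> \<in> elts \<beta> \<Longrightarrow> \<gamma> \<in> elts \<alpha>"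
  unfolding ON_def transitive_set_def by blast

lemma ON_linear:
  assumes "\<alpha> \<in> ON" "\<beta> \<in> ON"
  shows "\<alpha> \<in> elts \<beta> \<or> \<alpha> = \<beta> \<or> \<beta> \<in> elts \<alpha>"
  using assms
proof (induction \<alpha> arbitrary: \<beta> rule: wf_induct_rule[OF foundation])
  case (1 \<alpha>)
  note IH\<alpha> = 1
  show ?case
    using \<open>\<beta> \<in> ON\<close>
  proof (induction \<beta> rule: wf_induct_rule[OF foundation])
    case (1 \<beta>)
    \<comment> \<open>An element of either ordinal is comparable with the other one by the outer or
      the inner induction hypothesis; the unwanted outcomes would, by transitivity, make one of the
      two ordinals a member of the other.\<close>
    have "elts \<alpha> = elts \<beta>" if "\<alpha> \<notin> elts \<beta>" "\<beta> \<notin> elts \<alpha>"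
    proof (intro equalityI subsetI)
      fix \<epsilon> assume e: "\<epsilon> \<in> elts \<alpha>"
      then have "\<epsilon> \<in> elts \<beta> \<or> \<epsilon> = \<beta> \<or> \<beta> \<in> elts \<epsilon>"
        using IH\<alpha>(1)[of \<epsilon> \<beta>] 1(2) ON_elts[OF IH\<alpha>(2) e] by simp
      then show "\<epsilon> \<in> elts \<beta>"
        using that e ON_trans[OF IH\<alpha>(2) e, of \<beta>] by blast
    next
      fix \<epsilon> assume e: "\<epsilon> \<in> elts \<beta>"
      then have "\<alpha> \<in> elts \<epsilon> \<or> \<alpha> = \<epsilon> \<or> \<epsilon> \<in> elts \<alpha>"
        using 1(1)[of \<epsilon>] ON_elts[OF 1(2) e] by simp
      then show "\<epsilon> \<in> elts \<alpha>"
        using that e ON_trans[OF 1(2) e, of \<alpha>] by blast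
    qed
    then show ?case
      using extensionality by blast
  qed
qed

lemma ord_leD: "\<alpha> \<preceq> \<beta> \<Longrightarrow> \<alpha> \<in> ON \<and> \<beta> \<in> ON"
  by (simp add: ord_le_def)

lemma ord_lessD: "\<alpha> \<prec> \<beta> \<Longrightarrow> \<alpha> \<preceq> \<beta>"
  by (simp add: ord_le_def ord_less_def)

lemma ord_le_refl: "\<alpha> \<in> ON \<Longrightarrow> \<alpha> \<preceq> \<alpha>"
  by (simp add: ord_le_def)

lemma ord_le_trans: "\<alpha> \<preceq> \<beta> \<Longrightarrow> \<beta> \<preceq> \<gamma> \<Longrightarrow> \<alpha> \<preceq> \<gamma>"
  unfolding ord_le_def using ON_trans by blast

lemma ord_le_less_trans: "\<alpha> \<preceq> \<beta> \<Longrightarrow> \<beta> \<prec> \<gamma> \<Longrightarrow> \<alpha> \<prec> \<gamma>"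
  unfolding ord_le_def ord_less_def using ON_trans by blast

lemma not_ord_less: "\<alpha> \<in> ON \<Longrightarrow> \<beta> \<in> ON \<Longrightarrow> \<not> \<alpha> \<prec> \<beta> \<longleftrightarrow> \<beta> \<preceq> \<alpha>"
  unfolding ord_le_def ord_less_def using ON_linear ON_trans elts_irrefl by blast

lemma ord_le_imp_less_or_eq: "\<alpha> \<preceq> \<beta> \<Longrightarrow> \<alpha> \<prec> \<beta> \<or> \<alpha> = \<beta>"
  by (auto simp: ord_le_def ord_less_def)

lemma ord_le_antisym: "\<alpha> \<preceq> \<beta> \<Longrightarrow> \<beta> \<preceq> \<alpha> \<Longrightarrow> \<alpha> = \<beta>"
  using ord_le_imp_less_or_eq[of \<alpha> \<beta>] not_ord_less[of \<alpha> \<beta>] ord_leD[of \<alpha> \<beta>] by blast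

text \<open>A code of \<open>ON\<close> would be transitive with transitive elements, hence an
  ordinal and a member of itself, against foundation.\<close>

lemma ON_not_a_set: "\<not> is_a_set ON"
proof
  assume "is_a_set (ON :: 'a set)"
  then obtain w :: 'a where w: "elts w = ON"
    by (auto simp: is_a_set_def)
  then have "w \<in> ON"
    using ON_elts unfolding ON_def transitive_set_def by blast
  then show False
    using w elts_irrefl by blast
qed

text \<open>An ordinal that is not above \<alpha> is an element of \<alpha>, so the upper class
  together with its union covers \<open>ON\<close>.\<close>

lemma ordinals_above_not_a_set:
  assumes "\<alpha> \<in> ON"
  shows "\<not> is_a_set {\<beta>. \<alpha> \<preceq> \<beta>}"
proof
  assume *: "is_a_set {\<beta>. \<alpha> \<preceq> \<beta>}"
  have "ON \<subseteq> {\<beta>. \<alpha> \<preceq> \<beta>} \<union> (\<Union>\<beta>\<in>{\<beta>. \<alpha> \<preceq> \<beta>}. elts \<beta>)"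
    using ON_linear[OF assms] assms by (auto simp: ord_le_def)
  with is_a_set_Un[OF * is_a_set_Union[OF *]] show False
    using is_a_set_subset ON_not_a_set by blast
qed

section \<open>Strict chains of subsets indexed by ordinals\<close>

lemma strict_chain_reflects_less:
  assumes S: "\<And>\<delta> \<epsilon>. \<delta> \<prec> \<epsilon> \<Longrightarrow> \<epsilon> \<preceq> \<beta> \<Longrightarrow> S \<delta> \<subset> S \<epsilon>"
    and "\<delta> \<preceq> \<beta>" "\<epsilon> \<preceq> \<beta>" "S \<delta> \<subset> S \<epsilon>"
  shows "\<delta> \<prec> \<epsilon>"
proof (rule ccontr)
  assume "\<not> \<delta> \<prec> \<epsilon>"
  then have "\<epsilon> \<preceq> \<delta>"
    using not_ord_less assms(2,3) ord_leD by blast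
  then have "\<epsilon> \<prec> \<delta> \<or> \<epsilon> = \<delta>"
    by (rule ord_le_imp_less_or_eq)
  then have "S \<epsilon> \<subset> S \<delta> \<or> \<epsilon> = \<delta>"
    using S[of \<epsilon> \<delta>] assms(2) by blast
  then show False
    using assms(4) by blast
qed

text \<open>A chain of subsets of order type \<open>\<beta> + 1\<close> determines \<open>\<beta>\<close>, as its indexing can be
  recovered by recursion on \<open>\<in>\<close>.\<close>

lemma strict_chain_index_unique:
  assumes S: "\<And>\<delta> \<epsilon>. \<delta> \<prec> \<epsilon> \<Longrightarrow> \<epsilon> \<preceq> \<beta> \<Longrightarrow> S \<delta> \<subset> S \<epsilon>"
    and T: "\<And>\<delta> \<epsilon>. \<delta> \<prec> \<epsilon> \<Longrightarrow> \<epsilon> \<preceq> \<gamma> \<Longrightarrow> T \<delta> \<subset> T \<epsilon>"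
    and ran: "S ` {\<delta>. \<delta> \<preceq> \<beta>} = T ` {\<delta>. \<delta> \<preceq> \<gamma>}"
    and "\<delta> \<preceq> \<beta>" "\<epsilon> \<preceq> \<gamma>" "S \<delta> = T \<epsilon>"
  shows "\<delta> = \<epsilon>"
  using assms(4-6)
proof (induction \<delta> arbitrary: \<epsilon> rule: wf_induct_rule[OF foundation])
  case (1 \<delta>)
  have lessI: "\<zeta> \<prec> \<delta>" if "\<zeta> \<preceq> \<beta>" "S \<zeta> \<subset> S \<delta>" for \<zeta>
    using S that(1) 1(2) that(2) by (rule strict_chain_reflects_less)
  have lessI': "\<eta> \<prec> \<epsilon>" if "\<eta> \<preceq> \<gamma>" "T \<eta> \<subset> T \<epsilon>" for \<eta>
    using T that(1) 1(3) that(2) by (rule strict_chain_reflects_less)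
  have od: "\<delta> \<in> ON" and oe: "\<epsilon> \<in> ON"
    using 1(2,3) ord_leD by blast+
  \<comment> \<open>The members of the common range strictly below
    \<open>S \<delta> = T \<epsilon>\<close> are indexed by the elements of \<delta> on one side and
    by those of \<epsilon> on the other; the induction hypothesis says that both indexings agree
    there.\<close>
  have "elts \<delta> = elts \<epsilon>"
  proof (intro equalityI subsetI)
    fix \<zeta> assume z: "\<zeta> \<in> elts \<delta>"
    then have zd: "\<zeta> \<prec> \<delta>"
      using ON_elts[OF od z] od by (simp add: ord_less_def)
    then have zb: "\<zeta> \<preceq> \<beta>"
      using ord_le_trans[OF ord_lessD 1(2)] by simp
    then obtain \<eta> where eta: "\<eta> \<preceq> \<gamma>" "S \<zeta> = T \<eta>"
      using ran by blast
    have "\<zeta> = \<eta>"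
      using 1(1)[of \<zeta> \<eta>] z zb eta by simp
    moreover have "\<eta> \<prec> \<epsilon>"
      using S[OF zd 1(2)] lessI'[OF eta(1)] eta(2) 1(4) by simp
    ultimately show "\<zeta> \<in> elts \<epsilon>"
      by (simp add: ord_less_def)
  next
    fix \<eta> assume e: "\<eta> \<in> elts \<epsilon>"
    then have ee: "\<eta> \<prec> \<epsilon>"
      using ON_elts[OF oe e] oe by (simp add: ord_less_def)
    then have eg: "\<eta> \<preceq> \<gamma>"
      using ord_le_trans[OF ord_lessD 1(3)] by simp
    then have "T \<eta> \<in> S ` {\<delta>. \<delta> \<preceq> \<beta>}"
      unfolding ran by simp
    then obtain \<zeta> where zeta: "\<zeta> \<preceq> \<beta>" "S \<zeta> = T \<eta>"
      by auto
    have "\<zeta> \<prec> \<delta>"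
      using T[OF ee 1(3)] lessI[OF zeta(1)] zeta(2) 1(4) by simp
    then have "\<zeta> \<in> elts \<delta>"
      by (simp add: ord_less_def)
    moreover have "\<zeta> = \<eta>"
      using 1(1)[of \<zeta> \<eta>] calculation zeta eg by simp
    ultimately show "\<eta> \<in> elts \<delta>"
      by simp
  qed
  then show ?case
    by (rule extensionality)
qed

text \<open>The range of the chain for \<beta> is a subset of \<open>Pow X\<close> and determines
  \<beta>, so the ordinals from \<alpha> on would inject into the double power set of
  \<open>X\<close> and form a set.\<close>

lemma no_arbitrarily_long_strict_chains:
  fixes X :: "'v::zfc_universe set" and S :: "'v \<Rightarrow> 'v \<Rightarrow> 'v set"
  assumes X: "is_a_set X" and \<alpha>: "\<alpha> \<in> ON"
    and sub: "\<And>\<beta> \<delta>. \<alpha> \<preceq> \<beta> \<Longrightarrow> \<delta> \<preceq> \<beta> \<Longrightarrow> S \<beta> \<delta> \<subseteq> X"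
    and strict: "\<And>\<beta> \<delta> \<epsilon>. \<alpha> \<preceq> \<beta> \<Longrightarrow> \<delta> \<prec> \<epsilon> \<Longrightarrow> \<epsilon> \<preceq> \<beta> \<Longrightarrow> S \<beta> \<delta> \<subset> S \<beta> \<epsilon>"
  shows False
proof -
  define c :: "'v set \<Rightarrow> 'v" where "c = inv_into UNIV elts"
  define F where "F \<beta> = S \<beta> ` {\<delta>. \<delta> \<preceq> \<beta>}" for \<beta>
  have F: "F \<beta> \<subseteq> Pow X" if "\<alpha> \<preceq> \<beta>" for \<beta>
    using sub that by (auto simp: F_def)
  have PX: "is_a_set (c ` Pow X)"
    unfolding c_def by (rule is_a_set_Pow[OF X])
  have inj_c: "inj_on c {A. is_a_set A}"
    by (rule inj_on_inverseI[where g = elts]) (simp add: c_def elts_inv_elts)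
  \<comment> \<open>The range \<open>F \<beta>\<close> is a set of sets: the inner \<open>c\<close>
    codes its members, the outer \<open>c\<close> codes the resulting set of codes.\<close>
  have "inj_on (\<lambda>\<beta>. c (c ` F \<beta>)) {\<beta>. \<alpha> \<preceq> \<beta>}"
  proof (rule inj_onI, clarsimp)
    fix \<beta> \<gamma> assume b: "\<alpha> \<preceq> \<beta>" and g: "\<alpha> \<preceq> \<gamma>" and eq: "c (c ` F \<beta>) = c (c ` F \<gamma>)"
    have "is_a_set (c ` F \<beta>)" "is_a_set (c ` F \<gamma>)"
      using is_a_set_subset[OF PX image_mono[OF F[OF b]]]
        is_a_set_subset[OF PX image_mono[OF F[OF g]]] .
    with eq have "c ` F \<beta> = c ` F \<gamma>"
      by (intro inj_onD[OF inj_c]) simp_all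
    \<comment> \<open>Coding is injective on classes that are sets; the members of the ranges
      qualify as subsets of \<open>X\<close>.\<close>
    moreover have "F \<zeta> \<subseteq> {A. is_a_set A}" if "\<alpha> \<preceq> \<zeta>" for \<zeta>
      using F[OF that] by (intro subsetI CollectI is_a_set_subset[OF X]) auto
    then have "F \<beta> \<subseteq> {A. is_a_set A}" "F \<gamma> \<subseteq> {A. is_a_set A}"
      using b g by simp_all
    ultimately have FF: "F \<beta> = F \<gamma>"
      using inj_on_image_eq_iff[OF inj_c, of "F \<beta>" "F \<gamma>"] by simp
    have u: "\<delta> = \<epsilon>" if "\<delta> \<preceq> \<beta>" "\<epsilon> \<preceq> \<gamma>" "S \<beta> \<delta> = S \<gamma> \<epsilon>" for \<delta> \<epsilon>
      using strict[OF b] strict[OF g] FF[unfolded F_def] that by (rule strict_chain_index_unique)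
    have "\<beta> \<in> ON" "\<gamma> \<in> ON"
      using b g ord_leD by blast+
    then have refl: "\<beta> \<preceq> \<beta>" "\<gamma> \<preceq> \<gamma>"
      by (simp_all add: ord_le_refl)
    \<comment> \<open>The index sets contain their top elements \<beta> and \<gamma>. Matching the
      top of each chain with a member of the other one bounds each ordinal by the other.\<close>
    have "S \<beta> \<beta> \<in> F \<beta>" "S \<gamma> \<gamma> \<in> F \<gamma>"
      using refl by (simp_all add: F_def)
    then have "S \<beta> \<beta> \<in> F \<gamma>" "S \<gamma> \<gamma> \<in> F \<beta>"
      by (simp_all add: FF)
    then obtain \<delta> where "\<delta> \<preceq> \<gamma>" "S \<beta> \<beta> = S \<gamma> \<delta>"
      by (auto simp: F_def)
    then have "\<beta> \<preceq> \<gamma>"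
      using u[OF refl(1), of \<delta>] by simp
    obtain \<epsilon> where "\<epsilon> \<preceq> \<beta>" "S \<gamma> \<gamma> = S \<beta> \<epsilon>"
      using \<open>S \<gamma> \<gamma> \<in> F \<beta>\<close> by (auto simp: F_def)
    then have "\<gamma> \<preceq> \<beta>"
      using u[OF _ refl(2), of \<epsilon>] by simp
    with \<open>\<beta> \<preceq> \<gamma>\<close> show "\<beta> = \<gamma>"
      by (rule ord_le_antisym)
  qed
  moreover have "(\<lambda>\<beta>. c (c ` F \<beta>)) ` {\<beta>. \<alpha> \<preceq> \<beta>} \<subseteq> c ` Pow (c ` Pow X)"
    using F by blast
  ultimately have "is_a_set {\<beta>. \<alpha> \<preceq> \<beta>}"
    using is_a_set_Pow[OF PX, folded c_def] by (rule is_a_set_inj_on)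
  then show False
    using ordinals_above_not_a_set[OF \<alpha>] by simp
qed

section \<open>Linear maps and spans\<close>

lemma zero_submodule: "module R M \<Longrightarrow> submodule {\<zero>\<^bsub>M\<^esub>} R M"
proof -
  assume "module R M"
  then interpret module R M .
  show ?thesis
    by (rule submoduleI) auto
qed

lemma linear_map_zero:
  assumes "module R M" "module R N" "f \<in> linear_maps R M N"
  shows "f \<zero>\<^bsub>M\<^esub> = \<zero>\<^bsub>N\<^esub>"
proof -
  interpret M: module R M by fact
  interpret N: module R N by fact
  have "f (\<zero>\<^bsub>R\<^esub> \<odot>\<^bsub>M\<^esub> \<zero>\<^bsub>M\<^esub>) = \<zero>\<^bsub>R\<^esub> \<odot>\<^bsub>N\<^esub> f \<zero>\<^bsub>M\<^esub>" "f \<zero>\<^bsub>M\<^esub> \<in> carrier N"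
    using assms(3) M.R.zero_closed M.M.zero_closed unfolding linear_maps_def by blast+
  then show ?thesis
    by simp
qed

lemma linear_span_subset_submodule: "submodule H R M \<Longrightarrow> S \<subseteq> H \<Longrightarrow> linear_span R M S \<subseteq> H"
  unfolding linear_span_def by blast

lemma zero_in_linear_span: "\<zero>\<^bsub>M\<^esub> \<in> linear_span R M S"
  unfolding linear_span_def using subgroup.one_closed submodule.axioms(1) by fastforce

lemma linear_span_zero:
  assumes "module R M" "S \<subseteq> {\<zero>\<^bsub>M\<^esub>}"
  shows "linear_span R M S = {\<zero>\<^bsub>M\<^esub>}"
  using linear_span_subset_submodule[OF zero_submodule[OF assms(1)] assms(2)]
    zero_in_linear_span[of M R S] by blast

text \<open>Otherwise the nonzero scalar a - b, a unit, would annihilate \<open>v\<close>. This lets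
  a line through a nonzero vector distinguish scalars, and hence subfields.\<close>

lemma smult_right_cancel:
  assumes "field R" "module R M" and a: "a \<in> carrier R" and b: "b \<in> carrier R"
    and v: "v \<in> carrier M" "v \<noteq> \<zero>\<^bsub>M\<^esub>" and eq: "a \<odot>\<^bsub>M\<^esub> v = b \<odot>\<^bsub>M\<^esub> v"
  shows "a = b"
proof (rule ccontr)
  interpret R: field R by fact
  interpret M: module R M by fact
  assume "a \<noteq> b"
  define c where "c = a \<ominus>\<^bsub>R\<^esub> b"
  have c: "c \<in> carrier R" "c \<noteq> \<zero>\<^bsub>R\<^esub>"
    using a b \<open>a \<noteq> b\<close> by (auto simp: c_def)
  then have u: "c \<in> Units R"
    by (simp add: R.field_Units)
  have "c \<odot>\<^bsub>M\<^esub> v = \<zero>\<^bsub>M\<^esub>"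
    using a b v eq by (simp add: c_def a_minus_def M.smult_l_distr M.smult_l_minus M.M.r_neg)
  then have "inv\<^bsub>R\<^esub> c \<odot>\<^bsub>M\<^esub> (c \<odot>\<^bsub>M\<^esub> v) = \<zero>\<^bsub>M\<^esub>"
    using u by simp
  moreover have "(inv\<^bsub>R\<^esub> c \<otimes>\<^bsub>R\<^esub> c) \<odot>\<^bsub>M\<^esub> v = inv\<^bsub>R\<^esub> c \<odot>\<^bsub>M\<^esub> (c \<odot>\<^bsub>M\<^esub> v)"
    using u c v by (intro M.smult_assoc1) simp_all
  ultimately show False
    using u v by simp
qed

definition ring_module :: "('k, 'm) ring_scheme \<Rightarrow> ('k, 'k) module"
  where "ring_module R =
    \<lparr>carrier = carrier R, mult = mult R, one = one R, zero = zero R, add = add R, smult = mult R\<rparr>"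

lemma ring_module_simps [simp]:
  "carrier (ring_module R) = carrier R" "zero (ring_module R) = zero R"
  "add (ring_module R) = add R" "smult (ring_module R) = mult R"
  by (simp_all add: ring_module_def)

lemma ring_module_is_module:
  assumes "cring R"
  shows "module R (ring_module R)"
proof -
  interpret cring R by fact
  show ?thesis
  proof (rule moduleI)
    show "abelian_group (ring_module R)"
    proof (rule abelian_groupI)
      show "\<exists>y\<in>carrier (ring_module R). y \<oplus>\<^bsub>ring_module R\<^esub> x = \<zero>\<^bsub>ring_module R\<^esub>"
        if "x \<in> carrier (ring_module R)" for x
        using that l_neg[of x] a_inv_closed[of x] by auto
    qed (auto simp: a_ac)
  qed (use assms in \<open>auto simp: l_distr r_distr m_assoc\<close>)
qed


section \<open>Chains\<close>

locale tower_of_fields =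
  fixes k :: "'v::zfc_universe tower"
  assumes tower: "field_tower k"
begin

lemma
  assumes "\<alpha> \<in> ON"
  shows field_fld: "field (fld k \<alpha>)"
    and cring_fld: "cring (fld k \<alpha>)"
    and carrier_fld_set: "is_a_set (carrier (fld k \<alpha>))"
    and emb_refl: "a \<in> carrier (fld k \<alpha>) \<Longrightarrow> emb k \<alpha> \<alpha> a = a"
  using tower assms fieldE(1) unfolding field_tower_def by auto

lemma
  assumes "\<alpha> \<preceq> \<beta>"
  shows emb_hom: "emb k \<beta> \<alpha> \<in> ring_hom (fld k \<alpha>) (fld k \<beta>)"
    and emb_closed: "a \<in> carrier (fld k \<alpha>) \<Longrightarrow> emb k \<beta> \<alpha> a \<in> carrier (fld k \<beta>)"
    and emb_one: "emb k \<beta> \<alpha> \<one>\<^bsub>fld k \<alpha>\<^esub> = \<one>\<^bsub>fld k \<beta>\<^esub>"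
    and emb_zero: "emb k \<beta> \<alpha> \<zero>\<^bsub>fld k \<alpha>\<^esub> = \<zero>\<^bsub>fld k \<beta>\<^esub>"
    and emb_inj: "inj_on (emb k \<beta> \<alpha>) (carrier (fld k \<alpha>))"
proof -
  show h: "emb k \<beta> \<alpha> \<in> ring_hom (fld k \<alpha>) (fld k \<beta>)"
    using tower assms unfolding field_tower_def by auto
  have f: "field (fld k \<alpha>)" "field (fld k \<beta>)"
    using assms ord_leD field_fld by auto
  show "a \<in> carrier (fld k \<alpha>) \<Longrightarrow> emb k \<beta> \<alpha> a \<in> carrier (fld k \<beta>)"
    by (rule ring_hom_closed[OF h])
  show "emb k \<beta> \<alpha> \<one>\<^bsub>fld k \<alpha>\<^esub> = \<one>\<^bsub>fld k \<beta>\<^esub>"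
    by (rule ring_hom_one[OF h])
  show "emb k \<beta> \<alpha> \<zero>\<^bsub>fld k \<alpha>\<^esub> = \<zero>\<^bsub>fld k \<beta>\<^esub>"
    using ring_hom_zero[OF h] f[THEN fieldE(1)] cring.axioms(1) by blast
  show "inj_on (emb k \<beta> \<alpha>) (carrier (fld k \<alpha>))"
    by (rule non_trivial_field_hom_is_inj[OF h f])
qed

lemma emb_trans:
  "\<alpha> \<preceq> \<beta> \<Longrightarrow> \<beta> \<preceq> \<gamma> \<Longrightarrow> a \<in> carrier (fld k \<alpha>) \<Longrightarrow>
    emb k \<gamma> \<beta> (emb k \<beta> \<alpha> a) = emb k \<gamma> \<alpha> a"
  using tower unfolding field_tower_def by blast

lemma chain_objI:
  assumes "\<And>\<alpha>. \<alpha> \<in> ON \<Longrightarrow> module (fld k \<alpha>) (space V \<alpha>)"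
    and "\<And>\<alpha>. \<alpha> \<in> ON \<Longrightarrow> is_a_set (carrier (space V \<alpha>))"
    and "\<And>\<alpha> \<beta> x. \<alpha> \<preceq> \<beta> \<Longrightarrow> x \<in> carrier (space V \<alpha>) \<Longrightarrow> tmap V \<beta> \<alpha> x \<in> carrier (space V \<beta>)"
    and "\<And>\<alpha> \<beta> x y. \<alpha> \<preceq> \<beta> \<Longrightarrow> x \<in> carrier (space V \<alpha>) \<Longrightarrow> y \<in> carrier (space V \<alpha>) \<Longrightarrow>
      tmap V \<beta> \<alpha> (x \<oplus>\<^bsub>space V \<alpha>\<^esub> y) = tmap V \<beta> \<alpha> x \<oplus>\<^bsub>space V \<beta>\<^esub> tmap V \<beta> \<alpha> y"
    and "\<And>\<alpha> \<beta> a x. \<alpha> \<preceq> \<beta> \<Longrightarrow> a \<in> carrier (fld k \<alpha>) \<Longrightarrow> x \<in> carrier (space V \<alpha>) \<Longrightarrow>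
      tmap V \<beta> \<alpha> (a \<odot>\<^bsub>space V \<alpha>\<^esub> x) = emb k \<beta> \<alpha> a \<odot>\<^bsub>space V \<beta>\<^esub> tmap V \<beta> \<alpha> x"
    and "\<And>\<alpha> x. \<alpha> \<in> ON \<Longrightarrow> x \<in> carrier (space V \<alpha>) \<Longrightarrow> tmap V \<alpha> \<alpha> x = x"
    and "\<And>\<alpha> \<beta> \<gamma> x. \<alpha> \<preceq> \<beta> \<Longrightarrow> \<beta> \<preceq> \<gamma> \<Longrightarrow> x \<in> carrier (space V \<alpha>) \<Longrightarrow>
      tmap V \<gamma> \<beta> (tmap V \<beta> \<alpha> x) = tmap V \<gamma> \<alpha> x"
  shows "chain_obj k V"
  unfolding chain_obj_def linear_maps_def restrict_scalars_def using assms by auto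

lemma
  assumes "chain_obj k V" "\<alpha> \<in> ON"
  shows chain_module: "module (fld k \<alpha>) (space V \<alpha>)"
    and chain_set: "is_a_set (carrier (space V \<alpha>))"
    and tmap_refl: "x \<in> carrier (space V \<alpha>) \<Longrightarrow> tmap V \<alpha> \<alpha> x = x"
    and chain_zero_closed: "\<zero>\<^bsub>space V \<alpha>\<^esub> \<in> carrier (space V \<alpha>)"
    and chain_add_zero: "\<zero>\<^bsub>space V \<alpha>\<^esub> \<oplus>\<^bsub>space V \<alpha>\<^esub> \<zero>\<^bsub>space V \<alpha>\<^esub> = \<zero>\<^bsub>space V \<alpha>\<^esub>"
    and chain_smult_zero: "a \<in> carrier (fld k \<alpha>) \<Longrightarrow> a \<odot>\<^bsub>space V \<alpha>\<^esub> \<zero>\<^bsub>space V \<alpha>\<^esub> = \<zero>\<^bsub>space V \<alpha>\<^esub>"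
proof -
  show m: "module (fld k \<alpha>) (space V \<alpha>)" and "is_a_set (carrier (space V \<alpha>))"
    and "x \<in> carrier (space V \<alpha>) \<Longrightarrow> tmap V \<alpha> \<alpha> x = x"
    using assms unfolding chain_obj_def by auto
  interpret module "fld k \<alpha>" "space V \<alpha>" by (rule m)
  show "\<zero>\<^bsub>space V \<alpha>\<^esub> \<in> carrier (space V \<alpha>)"
    "\<zero>\<^bsub>space V \<alpha>\<^esub> \<oplus>\<^bsub>space V \<alpha>\<^esub> \<zero>\<^bsub>space V \<alpha>\<^esub> = \<zero>\<^bsub>space V \<alpha>\<^esub>"
    "a \<in> carrier (fld k \<alpha>) \<Longrightarrow> a \<odot>\<^bsub>space V \<alpha>\<^esub> \<zero>\<^bsub>space V \<alpha>\<^esub> = \<zero>\<^bsub>space V \<alpha>\<^esub>"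
    by simp_all
qed

lemma
  assumes "chain_obj k V" "\<alpha> \<preceq> \<beta>"
  shows tmap_closed: "x \<in> carrier (space V \<alpha>) \<Longrightarrow> tmap V \<beta> \<alpha> x \<in> carrier (space V \<beta>)"
    and tmap_add: "x \<in> carrier (space V \<alpha>) \<Longrightarrow> y \<in> carrier (space V \<alpha>) \<Longrightarrow>
      tmap V \<beta> \<alpha> (x \<oplus>\<^bsub>space V \<alpha>\<^esub> y) = tmap V \<beta> \<alpha> x \<oplus>\<^bsub>space V \<beta>\<^esub> tmap V \<beta> \<alpha> y"
    and tmap_smult: "a \<in> carrier (fld k \<alpha>) \<Longrightarrow> x \<in> carrier (space V \<alpha>) \<Longrightarrow>
      tmap V \<beta> \<alpha> (a \<odot>\<^bsub>space V \<alpha>\<^esub> x) = emb k \<beta> \<alpha> a \<odot>\<^bsub>space V \<beta>\<^esub> tmap V \<beta> \<alpha> x"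
    and tmap_zero: "tmap V \<beta> \<alpha> \<zero>\<^bsub>space V \<alpha>\<^esub> = \<zero>\<^bsub>space V \<beta>\<^esub>"
proof -
  have *: "tmap V \<beta> \<alpha> \<in> linear_maps (fld k \<alpha>) (space V \<alpha>)
      (restrict_scalars (emb k \<beta> \<alpha>) (space V \<beta>))"
    using assms unfolding chain_obj_def by blast
  have cl: "y \<in> carrier (space V \<alpha>) \<Longrightarrow> tmap V \<beta> \<alpha> y \<in> carrier (space V \<beta>)"
    and sm: "b \<in> carrier (fld k \<alpha>) \<Longrightarrow> y \<in> carrier (space V \<alpha>) \<Longrightarrow>
      tmap V \<beta> \<alpha> (b \<odot>\<^bsub>space V \<alpha>\<^esub> y) = emb k \<beta> \<alpha> b \<odot>\<^bsub>space V \<beta>\<^esub> tmap V \<beta> \<alpha> y" for b y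
    using * by (auto simp: linear_maps_def restrict_scalars_def)
  show "x \<in> carrier (space V \<alpha>) \<Longrightarrow> tmap V \<beta> \<alpha> x \<in> carrier (space V \<beta>)"
    by (rule cl)
  show "a \<in> carrier (fld k \<alpha>) \<Longrightarrow> x \<in> carrier (space V \<alpha>) \<Longrightarrow>
      tmap V \<beta> \<alpha> (a \<odot>\<^bsub>space V \<alpha>\<^esub> x) = emb k \<beta> \<alpha> a \<odot>\<^bsub>space V \<beta>\<^esub> tmap V \<beta> \<alpha> x"
    by (rule sm)
  show "x \<in> carrier (space V \<alpha>) \<Longrightarrow> y \<in> carrier (space V \<alpha>) \<Longrightarrow>
      tmap V \<beta> \<alpha> (x \<oplus>\<^bsub>space V \<alpha>\<^esub> y) = tmap V \<beta> \<alpha> x \<oplus>\<^bsub>space V \<beta>\<^esub> tmap V \<beta> \<alpha> y"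
    using * by (auto simp: linear_maps_def restrict_scalars_def)
  have o: "\<alpha> \<in> ON" "\<beta> \<in> ON"
    using assms(2) ord_leD by auto
  interpret A: module "fld k \<alpha>" "space V \<alpha>" by (rule chain_module[OF assms(1) o(1)])
  interpret B: module "fld k \<beta>" "space V \<beta>" by (rule chain_module[OF assms(1) o(2)])
  show "tmap V \<beta> \<alpha> \<zero>\<^bsub>space V \<alpha>\<^esub> = \<zero>\<^bsub>space V \<beta>\<^esub>"
    using sm[of "\<zero>\<^bsub>fld k \<alpha>\<^esub>" "\<zero>\<^bsub>space V \<alpha>\<^esub>"] emb_zero[OF assms(2)] cl by simp
qed

lemma tmap_trans:
  "chain_obj k V \<Longrightarrow> \<alpha> \<preceq> \<beta> \<Longrightarrow> \<beta> \<preceq> \<gamma> \<Longrightarrow> x \<in> carrier (space V \<alpha>) \<Longrightarrow>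
    tmap V \<gamma> \<beta> (tmap V \<beta> \<alpha> x) = tmap V \<gamma> \<alpha> x"
  unfolding chain_obj_def by blast

lemma chain_homI:
  assumes "\<And>\<alpha> x. \<alpha> \<in> ON \<Longrightarrow> x \<in> carrier (space V \<alpha>) \<Longrightarrow> f \<alpha> x \<in> carrier (space W \<alpha>)"
    and "\<And>\<alpha> x y. \<alpha> \<in> ON \<Longrightarrow> x \<in> carrier (space V \<alpha>) \<Longrightarrow> y \<in> carrier (space V \<alpha>) \<Longrightarrow>
      f \<alpha> (x \<oplus>\<^bsub>space V \<alpha>\<^esub> y) = f \<alpha> x \<oplus>\<^bsub>space W \<alpha>\<^esub> f \<alpha> y"
    and "\<And>\<alpha> a x. \<alpha> \<in> ON \<Longrightarrow> a \<in> carrier (fld k \<alpha>) \<Longrightarrow> x \<in> carrier (space V \<alpha>) \<Longrightarrow>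
      f \<alpha> (a \<odot>\<^bsub>space V \<alpha>\<^esub> x) = a \<odot>\<^bsub>space W \<alpha>\<^esub> f \<alpha> x"
    and "\<And>\<alpha> \<beta> x. \<alpha> \<preceq> \<beta> \<Longrightarrow> x \<in> carrier (space V \<alpha>) \<Longrightarrow>
      f \<beta> (tmap V \<beta> \<alpha> x) = tmap W \<beta> \<alpha> (f \<alpha> x)"
  shows "f \<in> chain_hom k V W"
  unfolding chain_hom_def linear_maps_def using assms by auto

lemma
  assumes "f \<in> chain_hom k V W" "\<alpha> \<in> ON"
  shows hom_closed: "x \<in> carrier (space V \<alpha>) \<Longrightarrow> f \<alpha> x \<in> carrier (space W \<alpha>)"
    and hom_add: "x \<in> carrier (space V \<alpha>) \<Longrightarrow> y \<in> carrier (space V \<alpha>) \<Longrightarrow>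
      f \<alpha> (x \<oplus>\<^bsub>space V \<alpha>\<^esub> y) = f \<alpha> x \<oplus>\<^bsub>space W \<alpha>\<^esub> f \<alpha> y"
    and hom_smult: "a \<in> carrier (fld k \<alpha>) \<Longrightarrow> x \<in> carrier (space V \<alpha>) \<Longrightarrow>
      f \<alpha> (a \<odot>\<^bsub>space V \<alpha>\<^esub> x) = a \<odot>\<^bsub>space W \<alpha>\<^esub> f \<alpha> x"
    and hom_zero: "chain_obj k V \<Longrightarrow> chain_obj k W \<Longrightarrow> f \<alpha> \<zero>\<^bsub>space V \<alpha>\<^esub> = \<zero>\<^bsub>space W \<alpha>\<^esub>"
proof -
  have *: "f \<alpha> \<in> linear_maps (fld k \<alpha>) (space V \<alpha>) (space W \<alpha>)"
    using assms by (simp add: chain_hom_def)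
  show "x \<in> carrier (space V \<alpha>) \<Longrightarrow> f \<alpha> x \<in> carrier (space W \<alpha>)"
    "x \<in> carrier (space V \<alpha>) \<Longrightarrow> y \<in> carrier (space V \<alpha>) \<Longrightarrow>
      f \<alpha> (x \<oplus>\<^bsub>space V \<alpha>\<^esub> y) = f \<alpha> x \<oplus>\<^bsub>space W \<alpha>\<^esub> f \<alpha> y"
    "a \<in> carrier (fld k \<alpha>) \<Longrightarrow> x \<in> carrier (space V \<alpha>) \<Longrightarrow>
      f \<alpha> (a \<odot>\<^bsub>space V \<alpha>\<^esub> x) = a \<odot>\<^bsub>space W \<alpha>\<^esub> f \<alpha> x"
    using * by (auto simp: linear_maps_def)
  show "chain_obj k V \<Longrightarrow> chain_obj k W \<Longrightarrow> f \<alpha> \<zero>\<^bsub>space V \<alpha>\<^esub> = \<zero>\<^bsub>space W \<alpha>\<^esub>"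
    using linear_map_zero[OF _ _ *] chain_module assms(2) by blast
qed

lemma hom_natural:
  "f \<in> chain_hom k V W \<Longrightarrow> \<alpha> \<preceq> \<beta> \<Longrightarrow> x \<in> carrier (space V \<alpha>) \<Longrightarrow>
    f \<beta> (tmap V \<beta> \<alpha> x) = tmap W \<beta> \<alpha> (f \<alpha> x)"
  by (simp add: chain_hom_def)

lemma grounded_chains_obj: "V \<in> grounded_chains k \<Longrightarrow> chain_obj k V"
  by (simp add: grounded_chains_def)


subsection \<open>The free chain on one generator\<close>

text \<open>The object representing evaluation in degree \<alpha>: morphisms from it to a chain
  correspond to elements of the space in degree \<alpha>. It is cut out of the family of all
  \<open>fld k \<beta>\<close> by shrinking carriers, so that the transition maps are
  \<open>emb k\<close> and inclusions between free chains are identities in every degree.\<close>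

definition free_chain :: "'v \<Rightarrow> 'v chain"
  where "free_chain \<alpha> =
    \<lparr>space = (\<lambda>\<beta>. (ring_module (fld k \<beta>))
       \<lparr>carrier := if \<alpha> \<preceq> \<beta> then carrier (fld k \<beta>) else {\<zero>\<^bsub>fld k \<beta>\<^esub>}\<rparr>),
     tmap = emb k\<rparr>"

lemma free_chain_simps [simp]:
  "carrier (space (free_chain \<alpha>) \<beta>) = (if \<alpha> \<preceq> \<beta> then carrier (fld k \<beta>) else {\<zero>\<^bsub>fld k \<beta>\<^esub>})"
  "zero (space (free_chain \<alpha>) \<beta>) = zero (fld k \<beta>)"
  "add (space (free_chain \<alpha>) \<beta>) = add (fld k \<beta>)"
  "smult (space (free_chain \<alpha>) \<beta>) = mult (fld k \<beta>)"
  "tmap (free_chain \<alpha>) = emb k"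
  by (simp_all add: free_chain_def)

lemma free_chain_carrier_subset:
  "\<beta> \<in> ON \<Longrightarrow> carrier (space (free_chain \<alpha>) \<beta>) \<subseteq> carrier (fld k \<beta>)"
  using cring.cring_simprules(2)[OF cring_fld] by simp

lemma free_chain_obj: "chain_obj k (free_chain \<alpha>)"
proof (rule chain_objI)
  fix \<beta> :: 'v assume b: "\<beta> \<in> ON"
  have m: "module (fld k \<beta>) (ring_module (fld k \<beta>))"
    by (rule ring_module_is_module[OF cring_fld[OF b]])
  have "module (fld k \<beta>) ((ring_module (fld k \<beta>))
      \<lparr>carrier := if \<alpha> \<preceq> \<beta> then carrier (ring_module (fld k \<beta>)) else {\<zero>\<^bsub>ring_module (fld k \<beta>)\<^esub>}\<rparr>)"
    by (rule submodule.submodule_is_module[OF _ m])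
      (simp only: module.carrier_is_submodule[OF m] zero_submodule[OF m] split: if_split; simp)
  then show "module (fld k \<beta>) (space (free_chain \<alpha>) \<beta>)"
    by (simp add: free_chain_def cong: if_cong split del: if_split)
  show "is_a_set (carrier (space (free_chain \<alpha>) \<beta>))"
    by (rule is_a_set_subset[OF carrier_fld_set[OF b] free_chain_carrier_subset[OF b]])
next
  fix \<beta> \<gamma> x assume le: "\<beta> \<preceq> \<gamma>" and x: "x \<in> carrier (space (free_chain \<alpha>) \<beta>)"
  then have "\<alpha> \<preceq> \<beta> \<Longrightarrow> \<alpha> \<preceq> \<gamma>"
    using ord_le_trans by blast
  moreover have "\<zero>\<^bsub>fld k \<gamma>\<^esub> \<in> carrier (fld k \<gamma>)"
    using le ord_leD cring_fld cring.cring_simprules(2) by blast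
  ultimately show "tmap (free_chain \<alpha>) \<gamma> \<beta> x \<in> carrier (space (free_chain \<alpha>) \<gamma>)"
    using emb_closed[OF le] emb_zero[OF le] x by (auto split: if_splits)
next
  fix \<beta> \<gamma> x y
  assume le: "\<beta> \<preceq> \<gamma>" and "x \<in> carrier (space (free_chain \<alpha>) \<beta>)"
  then have x: "x \<in> carrier (fld k \<beta>)"
    using subsetD[OF free_chain_carrier_subset] ord_leD by blast
  show "tmap (free_chain \<alpha>) \<gamma> \<beta> (a \<odot>\<^bsub>space (free_chain \<alpha>) \<beta>\<^esub> x) =
      emb k \<gamma> \<beta> a \<odot>\<^bsub>space (free_chain \<alpha>) \<gamma>\<^esub> tmap (free_chain \<alpha>) \<gamma> \<beta> x"
    if "a \<in> carrier (fld k \<beta>)" for a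
    using ring_hom_mult[OF emb_hom[OF le] that x] by simp
  assume "y \<in> carrier (space (free_chain \<alpha>) \<beta>)"
  then have y: "y \<in> carrier (fld k \<beta>)"
    using subsetD[OF free_chain_carrier_subset] ord_leD[OF le] by blast
  show "tmap (free_chain \<alpha>) \<gamma> \<beta> (x \<oplus>\<^bsub>space (free_chain \<alpha>) \<beta>\<^esub> y) =
      tmap (free_chain \<alpha>) \<gamma> \<beta> x \<oplus>\<^bsub>space (free_chain \<alpha>) \<gamma>\<^esub> tmap (free_chain \<alpha>) \<gamma> \<beta> y"
    using ring_hom_add[OF emb_hom[OF le] x y] by simp
next
  fix \<beta> x assume b: "\<beta> \<in> ON" and x: "x \<in> carrier (space (free_chain \<alpha>) \<beta>)"
  show "tmap (free_chain \<alpha>) \<beta> \<beta> x = x"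
    using emb_refl[OF b] subsetD[OF free_chain_carrier_subset[OF b] x] by simp
next
  fix \<beta> \<gamma> \<delta> x
  assume le: "\<beta> \<preceq> \<gamma>" "\<gamma> \<preceq> \<delta>" and "x \<in> carrier (space (free_chain \<alpha>) \<beta>)"
  then have "x \<in> carrier (fld k \<beta>)"
    using subsetD[OF free_chain_carrier_subset] ord_leD by blast
  then show "tmap (free_chain \<alpha>) \<delta> \<gamma> (tmap (free_chain \<alpha>) \<gamma> \<beta> x) = tmap (free_chain \<alpha>) \<delta> \<beta> x"
    using emb_trans[OF le] by simp
qed

text \<open>Beyond \<alpha> each field is spanned over itself by its unit, which is the image of the
  unit in degree \<alpha>.\<close>

lemma free_chain_grounded:
  assumes "\<alpha> \<in> ON"
  shows "free_chain \<alpha> \<in> grounded_chains k"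
proof -
  have "grounded_at k \<alpha> (free_chain \<alpha>)"
    unfolding grounded_at_def
  proof (intro allI impI)
    fix \<beta> :: 'v assume "\<alpha> \<prec> \<beta>"
    then have le: "\<alpha> \<preceq> \<beta>" and b: "\<beta> \<in> ON"
      using ord_lessD ord_leD by blast+
    interpret R: cring "fld k \<beta>"
      by (rule cring_fld[OF b])
    interpret A: cring "fld k \<alpha>"
      by (rule cring_fld[OF assms])
    interpret M: module "fld k \<beta>" "space (free_chain \<alpha>) \<beta>"
      by (rule chain_module[OF free_chain_obj b])
    let ?S = "tmap (free_chain \<alpha>) \<beta> \<alpha> ` carrier (space (free_chain \<alpha>) \<alpha>)"
    have one: "\<one>\<^bsub>fld k \<beta>\<^esub> \<in> ?S"
      using emb_one[OF le] ord_le_refl[OF assms] by (auto intro!: image_eqI[of _ _ "\<one>\<^bsub>fld k \<alpha>\<^esub>"])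
    have "carrier (space (free_chain \<alpha>) \<beta>) \<subseteq> linear_span (fld k \<beta>) (space (free_chain \<alpha>) \<beta>) ?S"
      unfolding linear_span_def
    proof (intro subsetI InterI, clarify)
      fix x H
      assume x: "x \<in> carrier (space (free_chain \<alpha>) \<beta>)"
        and H: "submodule H (fld k \<beta>) (space (free_chain \<alpha>) \<beta>)" and S: "?S \<subseteq> H"
      have "x \<odot>\<^bsub>space (free_chain \<alpha>) \<beta>\<^esub> \<one>\<^bsub>fld k \<beta>\<^esub> \<in> H"
        using submodule.smult_closed[OF H, of x "\<one>\<^bsub>fld k \<beta>\<^esub>"] x le subsetD[OF S one] by simp
      then show "x \<in> H"
        using x le by simp
    qed
    moreover have "linear_span (fld k \<beta>) (space (free_chain \<alpha>) \<beta>) ?S \<subseteq> carrier (space (free_chain \<alpha>) \<beta>)"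
      using tmap_closed[OF free_chain_obj le]
      by (intro linear_span_subset_submodule M.carrier_is_submodule) blast
    ultimately show "carrier (space (free_chain \<alpha>) \<beta>) =
        linear_span (fld k \<beta>) (space (free_chain \<alpha>) \<beta>) ?S"
      by blast
  qed
  then show ?thesis
    using assms free_chain_obj by (auto simp: grounded_chains_def)
qed

text \<open>The morphism sending the generator, the unit in degree \<alpha>, to \<open>x\<close>.
  The default value zero covers degrees in which the free chain is zero.\<close>

definition free_chain_lift :: "'v chain \<Rightarrow> 'v \<Rightarrow> 'v \<Rightarrow> 'v \<Rightarrow> 'v \<Rightarrow> 'v"
  where "free_chain_lift A \<alpha> x \<beta> c =
    (if \<alpha> \<preceq> \<beta> then c \<odot>\<^bsub>space A \<beta>\<^esub> tmap A \<beta> \<alpha> x else \<zero>\<^bsub>space A \<beta>\<^esub>)"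

lemma free_chain_lift_hom:
  assumes A: "chain_obj k A" and x: "x \<in> carrier (space A \<alpha>)"
  shows "free_chain_lift A \<alpha> x \<in> chain_hom k (free_chain \<alpha>) A"
proof (rule chain_homI)
  fix \<beta> c d assume b: "\<beta> \<in> ON" and c: "c \<in> carrier (space (free_chain \<alpha>) \<beta>)"
  interpret module "fld k \<beta>" "space A \<beta>" by (rule chain_module[OF A b])
  have cl: "\<alpha> \<preceq> \<beta> \<Longrightarrow> tmap A \<beta> \<alpha> x \<in> carrier (space A \<beta>)"
    using tmap_closed[OF A _ x] by simp
  show "free_chain_lift A \<alpha> x \<beta> c \<in> carrier (space A \<beta>)"
    using cl c by (cases "\<alpha> \<preceq> \<beta>") (simp_all add: free_chain_lift_def)
  show "free_chain_lift A \<alpha> x \<beta> (c \<oplus>\<^bsub>space (free_chain \<alpha>) \<beta>\<^esub> d) =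
      free_chain_lift A \<alpha> x \<beta> c \<oplus>\<^bsub>space A \<beta>\<^esub> free_chain_lift A \<alpha> x \<beta> d"
    if "d \<in> carrier (space (free_chain \<alpha>) \<beta>)"
    using cl c that by (cases "\<alpha> \<preceq> \<beta>") (simp_all add: free_chain_lift_def smult_l_distr)
  show "free_chain_lift A \<alpha> x \<beta> (d \<odot>\<^bsub>space (free_chain \<alpha>) \<beta>\<^esub> c) =
      d \<odot>\<^bsub>space A \<beta>\<^esub> free_chain_lift A \<alpha> x \<beta> c" if "d \<in> carrier (fld k \<beta>)"
    using cl c that by (cases "\<alpha> \<preceq> \<beta>") (simp_all add: free_chain_lift_def smult_assoc1)
next
  fix \<beta> \<gamma> c assume le: "\<beta> \<preceq> \<gamma>" and c: "c \<in> carrier (space (free_chain \<alpha>) \<beta>)"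
  interpret C: module "fld k \<gamma>" "space A \<gamma>"
    using chain_module[OF A] ord_leD[OF le] by simp
  show "free_chain_lift A \<alpha> x \<gamma> (tmap (free_chain \<alpha>) \<gamma> \<beta> c) =
      tmap A \<gamma> \<beta> (free_chain_lift A \<alpha> x \<beta> c)"
  proof (cases "\<alpha> \<preceq> \<beta>")
    case True
    then have "\<alpha> \<preceq> \<gamma>"
      using le ord_le_trans by blast
    then show ?thesis
      using True c tmap_closed[OF A True x]
      by (simp add: free_chain_lift_def tmap_smult[OF A le] tmap_trans[OF A True le x])
  next
    \<comment> \<open>Here \<open>c\<close> is zero, so both sides vanish whether or not \<gamma>
      has reached \<alpha>.\<close>
    case False
    then show ?thesis
      using c tmap_closed[OF A _ x]
      by (simp add: free_chain_lift_def tmap_zero[OF A le] emb_zero[OF le])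
  qed
qed

section \<open>Monomorphisms and injectivity in every degree\<close>

text \<open>Elements \<open>x\<close> and \<open>y\<close> with the same image give lifts from the
  free chain that agree after composition with \<open>m\<close>. Cancelling \<open>m\<close> and
  evaluating at the unit in degree \<alpha> returns \<open>x\<close> and \<open>y\<close>.\<close>

lemma monomorphism_injective:
  assumes m: "monomorphism_in k (grounded_chains k) A B m"
    and A: "chain_obj k A" and a: "\<alpha> \<in> ON"
  shows "inj_on (m \<alpha>) (carrier (space A \<alpha>))"
proof (rule inj_onI)
  fix x y assume x: "x \<in> carrier (space A \<alpha>)" and y: "y \<in> carrier (space A \<alpha>)" and eq: "m \<alpha> x = m \<alpha> y"
  have mh: "m \<in> chain_hom k A B"
    using m by (simp add: monomorphism_in_def)
  \<comment> \<open>After composition with \<open>m\<close> the lift depends on \<open>z\<close>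
    only through \<open>m \<alpha> z\<close>.\<close>
  have *: "m \<beta> (free_chain_lift A \<alpha> z \<beta> c) =
      (if \<alpha> \<preceq> \<beta> then c \<odot>\<^bsub>space B \<beta>\<^esub> tmap B \<beta> \<alpha> (m \<alpha> z) else m \<beta> \<zero>\<^bsub>space A \<beta>\<^esub>)"
    if "z \<in> carrier (space A \<alpha>)" "\<beta> \<in> ON" "c \<in> carrier (space (free_chain \<alpha>) \<beta>)" for z \<beta> c
    using that tmap_closed[OF A _ that(1)] hom_smult[OF mh that(2)] hom_natural[OF mh _ that(1)]
    by (cases "\<alpha> \<preceq> \<beta>") (simp_all add: free_chain_lift_def)
  have "chain_hom_eq (free_chain \<alpha>) (chain_comp m (free_chain_lift A \<alpha> x))
      (chain_comp m (free_chain_lift A \<alpha> y))"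
    unfolding chain_hom_eq_def chain_comp_def using *[OF x] *[OF y] eq by simp
  then have "chain_hom_eq (free_chain \<alpha>) (free_chain_lift A \<alpha> x) (free_chain_lift A \<alpha> y)"
    using m free_chain_grounded[OF a] free_chain_lift_hom[OF A x] free_chain_lift_hom[OF A y]
    unfolding monomorphism_in_def by blast
  moreover have "free_chain_lift A \<alpha> z \<alpha> \<one>\<^bsub>fld k \<alpha>\<^esub> = z" if "z \<in> carrier (space A \<alpha>)" for z
    using that tmap_refl[OF A a that] ord_le_refl[OF a] module.smult_one[OF chain_module[OF A a]]
    by (simp add: free_chain_lift_def)
  moreover have "\<one>\<^bsub>fld k \<alpha>\<^esub> \<in> carrier (space (free_chain \<alpha>) \<alpha>)"
    using ord_le_refl[OF a] cring_fld[OF a] cring.cring_simprules(6) by simp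
  ultimately show "x = y"
    using a x y unfolding chain_hom_eq_def by metis
qed

text \<open>The class \<open>\<C>\<close> of test objects is arbitrary, so the criterion serves all
  grounded chains and the truncated ones alike.\<close>

lemma injective_monomorphism:
  assumes "m \<in> chain_hom k A B" "\<And>\<alpha>. \<alpha> \<in> ON \<Longrightarrow> inj_on (m \<alpha>) (carrier (space A \<alpha>))"
  shows "monomorphism_in k \<C> A B m"
  unfolding monomorphism_in_def
proof (intro conjI assms(1) ballI impI)
  fix Z g h
  assume g: "g \<in> chain_hom k Z A" and h: "h \<in> chain_hom k Z A"
    and eq: "chain_hom_eq Z (chain_comp m g) (chain_comp m h)"
  show "chain_hom_eq Z g h"
    unfolding chain_hom_eq_def
  proof (intro ballI)
    fix \<alpha> x assume a: "\<alpha> \<in> ON" and x: "x \<in> carrier (space Z \<alpha>)"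
    then have "m \<alpha> (g \<alpha> x) = m \<alpha> (h \<alpha> x)"
      using eq by (simp add: chain_hom_eq_def chain_comp_def)
    then show "g \<alpha> x = h \<alpha> x"
      using inj_onD[OF assms(2)[OF a]] hom_closed[OF g a x] hom_closed[OF h a x] by blast
  qed
qed


subsection \<open>Truncation\<close>

text \<open>The quotient of \<open>V\<close> by its part in degrees from \<alpha> on. Only carriers
  shrink, so components of morphisms can be reused unchanged; transition maps crossing \<alpha> have
  to be redefined, as they must land in zero.\<close>

definition truncation :: "'v \<Rightarrow> 'v chain \<Rightarrow> 'v chain"
  where "truncation \<alpha> V =
    \<lparr>space = (\<lambda>\<beta>. (space V \<beta>)
       \<lparr>carrier := if \<beta> \<prec> \<alpha> then carrier (space V \<beta>) else {\<zero>\<^bsub>space V \<beta>\<^esub>}\<rparr>),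
     tmap = (\<lambda>\<gamma> \<beta> x. if \<gamma> \<prec> \<alpha> then tmap V \<gamma> \<beta> x else \<zero>\<^bsub>space V \<gamma>\<^esub>)\<rparr>"

lemma truncation_simps [simp]:
  "carrier (space (truncation \<alpha> V) \<beta>) = (if \<beta> \<prec> \<alpha> then carrier (space V \<beta>) else {\<zero>\<^bsub>space V \<beta>\<^esub>})"
  "zero (space (truncation \<alpha> V) \<beta>) = zero (space V \<beta>)"
  "add (space (truncation \<alpha> V) \<beta>) = add (space V \<beta>)"
  "smult (space (truncation \<alpha> V) \<beta>) = smult (space V \<beta>)"
  "tmap (truncation \<alpha> V) \<gamma> \<beta> x = (if \<gamma> \<prec> \<alpha> then tmap V \<gamma> \<beta> x else \<zero>\<^bsub>space V \<gamma>\<^esub>)"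
  by (simp_all add: truncation_def)

lemma truncation_obj:
  assumes V: "chain_obj k V"
  shows "chain_obj k (truncation \<alpha> V)"
proof (rule chain_objI)
  fix \<beta> :: 'v assume b: "\<beta> \<in> ON"
  note m = chain_module[OF V b]
  have "submodule (if \<beta> \<prec> \<alpha> then carrier (space V \<beta>) else {\<zero>\<^bsub>space V \<beta>\<^esub>}) (fld k \<beta>) (space V \<beta>)"
    by (simp add: module.carrier_is_submodule[OF m] zero_submodule[OF m])
  from submodule.submodule_is_module[OF this m]
  show "module (fld k \<beta>) (space (truncation \<alpha> V) \<beta>)"
    by (simp add: truncation_def)
  show "is_a_set (carrier (space (truncation \<alpha> V) \<beta>))"
    using chain_set[OF V b] is_a_set_singleton[of "\<zero>\<^bsub>space V \<beta>\<^esub>"] by simp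
next
  fix \<beta> \<gamma> x y
  assume le: "\<beta> \<preceq> \<gamma>" and x: "x \<in> carrier (space (truncation \<alpha> V) \<beta>)"
  \<comment> \<open>A transition map with target below \<alpha> also has its source there, so it is
    the one of \<open>V\<close>; all others are zero.\<close>
  have bg: "\<beta> \<prec> \<alpha>" if "\<gamma> \<prec> \<alpha>"
    using that le ord_le_less_trans by blast
  have g: "\<gamma> \<in> ON"
    using le ord_leD by blast
  show "tmap (truncation \<alpha> V) \<gamma> \<beta> x \<in> carrier (space (truncation \<alpha> V) \<gamma>)"
    using x bg tmap_closed[OF V le] by (cases "\<gamma> \<prec> \<alpha>") simp_all
  show "tmap (truncation \<alpha> V) \<gamma> \<beta> (x \<oplus>\<^bsub>space (truncation \<alpha> V) \<beta>\<^esub> y) =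
      tmap (truncation \<alpha> V) \<gamma> \<beta> x \<oplus>\<^bsub>space (truncation \<alpha> V) \<gamma>\<^esub> tmap (truncation \<alpha> V) \<gamma> \<beta> y"
    if "y \<in> carrier (space (truncation \<alpha> V) \<beta>)"
    using x that bg tmap_add[OF V le] chain_add_zero[OF V g] by (cases "\<gamma> \<prec> \<alpha>") simp_all
  show "tmap (truncation \<alpha> V) \<gamma> \<beta> (a \<odot>\<^bsub>space (truncation \<alpha> V) \<beta>\<^esub> x) =
      emb k \<gamma> \<beta> a \<odot>\<^bsub>space (truncation \<alpha> V) \<gamma>\<^esub> tmap (truncation \<alpha> V) \<gamma> \<beta> x"
    if "a \<in> carrier (fld k \<beta>)" for a
    using x that bg tmap_smult[OF V le that] chain_smult_zero[OF V g emb_closed[OF le that]] by (cases "\<gamma> \<prec> \<alpha>") simp_all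
next
  fix \<beta> x assume "\<beta> \<in> ON" "x \<in> carrier (space (truncation \<alpha> V) \<beta>)"
  then show "tmap (truncation \<alpha> V) \<beta> \<beta> x = x"
    using tmap_refl[OF V] by (simp split: if_splits)
next
  fix \<beta> \<gamma> \<delta> x
  assume le: "\<beta> \<preceq> \<gamma>" "\<gamma> \<preceq> \<delta>" and x: "x \<in> carrier (space (truncation \<alpha> V) \<beta>)"
  have "\<gamma> \<prec> \<alpha>" "\<beta> \<prec> \<alpha>" if "\<delta> \<prec> \<alpha>"
    using that le ord_le_less_trans by blast+
  then show "tmap (truncation \<alpha> V) \<delta> \<gamma> (tmap (truncation \<alpha> V) \<gamma> \<beta> x) = tmap (truncation \<alpha> V) \<delta> \<beta> x"
    using x tmap_trans[OF V le] by (cases "\<delta> \<prec> \<alpha>") simp_all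
qed

text \<open>The truncation is grounded at \<alpha> itself: beyond it, both the space and the span of
  the image are zero.\<close>

lemma truncation_below:
  assumes V: "chain_obj k V" and a: "\<alpha> \<in> ON"
  shows "truncation \<alpha> V \<in> grounded_chains_below k \<alpha>"
proof -
  have z: "carrier (space (truncation \<alpha> V) \<beta>) = {\<zero>\<^bsub>space (truncation \<alpha> V) \<beta>\<^esub>}" if "\<alpha> \<preceq> \<beta>" for \<beta>
    using not_ord_less[of \<beta> \<alpha>] a that ord_leD[OF that] by simp
  have "grounded_at k \<alpha> (truncation \<alpha> V)"
    unfolding grounded_at_def
  proof (intro allI impI)
    fix \<beta> :: 'v assume "\<alpha> \<prec> \<beta>"
    then have le: "\<alpha> \<preceq> \<beta>" and b: "\<beta> \<in> ON"
      using ord_lessD ord_leD by blast+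
    have "tmap (truncation \<alpha> V) \<beta> \<alpha> ` carrier (space (truncation \<alpha> V) \<alpha>)
        \<subseteq> {\<zero>\<^bsub>space (truncation \<alpha> V) \<beta>\<^esub>}"
      using tmap_closed[OF truncation_obj[OF V] le] z[OF le] by blast
    from linear_span_zero[OF chain_module[OF truncation_obj[OF V] b] this]
    show "carrier (space (truncation \<alpha> V) \<beta>) = linear_span (fld k \<beta>) (space (truncation \<alpha> V) \<beta>)
        (tmap (truncation \<alpha> V) \<beta> \<alpha> ` carrier (space (truncation \<alpha> V) \<alpha>))"
      using z[OF le] by simp
  qed
  then show ?thesis
    unfolding grounded_chains_below_def grounded_chains_def
    using z a truncation_obj[OF V] by blast
qed

lemma truncation_carrier_subset:
  "chain_obj k V \<Longrightarrow> \<beta> \<in> ON \<Longrightarrow> carrier (space (truncation \<alpha> V) \<beta>) \<subseteq> carrier (space V \<beta>)"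
  using chain_zero_closed by simp

text \<open>One half of the adjunction: a morphism into a chain vanishing from \<alpha> on kills the
  part of \<open>V\<close> that truncation removes, so it factors through the quotient with the same
  components.\<close>

lemma hom_from_truncation:
  assumes V: "chain_obj k V" and W: "chain_obj k W" and a: "\<alpha> \<in> ON"
    and z: "\<And>\<beta>. \<alpha> \<preceq> \<beta> \<Longrightarrow> carrier (space W \<beta>) = {\<zero>\<^bsub>space W \<beta>\<^esub>}"
    and f: "f \<in> chain_hom k V W"
  shows "f \<in> chain_hom k (truncation \<alpha> V) W"
proof (rule chain_homI)
  fix \<beta> x y assume b: "\<beta> \<in> ON" and "x \<in> carrier (space (truncation \<alpha> V) \<beta>)"
  then have x: "x \<in> carrier (space V \<beta>)"
    using truncation_carrier_subset[OF V b] by blast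
  show "f \<beta> x \<in> carrier (space W \<beta>)"
    by (rule hom_closed[OF f b x])
  show "f \<beta> (x \<oplus>\<^bsub>space (truncation \<alpha> V) \<beta>\<^esub> y) = f \<beta> x \<oplus>\<^bsub>space W \<beta>\<^esub> f \<beta> y"
    if "y \<in> carrier (space (truncation \<alpha> V) \<beta>)"
    using hom_add[OF f b x] truncation_carrier_subset[OF V b] that by (metis subsetD truncation_simps(3))
  show "f \<beta> (c \<odot>\<^bsub>space (truncation \<alpha> V) \<beta>\<^esub> x) = c \<odot>\<^bsub>space W \<beta>\<^esub> f \<beta> x" if "c \<in> carrier (fld k \<beta>)" for c
    using hom_smult[OF f b that x] by simp
next
  fix \<beta> \<gamma> x assume le: "\<beta> \<preceq> \<gamma>" and "x \<in> carrier (space (truncation \<alpha> V) \<beta>)"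
  then have o: "\<beta> \<in> ON" "\<gamma> \<in> ON" and x: "x \<in> carrier (space V \<beta>)"
    using ord_leD truncation_carrier_subset[OF V] by blast+
  show "f \<gamma> (tmap (truncation \<alpha> V) \<gamma> \<beta> x) = tmap W \<gamma> \<beta> (f \<beta> x)"
  proof (cases "\<gamma> \<prec> \<alpha>")
    case True
    then show ?thesis
      using hom_natural[OF f le x] by simp
  next
    case False
    then have "tmap W \<gamma> \<beta> (f \<beta> x) = \<zero>\<^bsub>space W \<gamma>\<^esub>"
      using z[of \<gamma>] not_ord_less[OF o(2) a] tmap_closed[OF W le hom_closed[OF f o(1) x]] by blast
    then show ?thesis
      using False hom_zero[OF f o(2) V W] by simp
  qed
qed

text \<open>The other half of the adjunction: composition with the projection onto the truncation.
  From \<alpha> on, the total function \<open>f\<close> is controlled at zero alone, whence the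
  overwriting by zero.\<close>

lemma hom_extend_by_zero:
  assumes V: "chain_obj k V" and W: "chain_obj k W" and a: "\<alpha> \<in> ON"
    and z: "\<And>\<beta>. \<alpha> \<preceq> \<beta> \<Longrightarrow> carrier (space W \<beta>) = {\<zero>\<^bsub>space W \<beta>\<^esub>}"
    and f: "f \<in> chain_hom k (truncation \<alpha> V) W"
  shows "(\<lambda>\<beta> x. if \<beta> \<prec> \<alpha> then f \<beta> x else \<zero>\<^bsub>space W \<beta>\<^esub>) \<in> chain_hom k V W"
proof (rule chain_homI)
  fix \<beta> x y assume b: "\<beta> \<in> ON" and x: "x \<in> carrier (space V \<beta>)"
  show "(if \<beta> \<prec> \<alpha> then f \<beta> x else \<zero>\<^bsub>space W \<beta>\<^esub>) \<in> carrier (space W \<beta>)"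
    using hom_closed[OF f b] x chain_zero_closed[OF W b] by simp
  show "(if \<beta> \<prec> \<alpha> then f \<beta> (x \<oplus>\<^bsub>space V \<beta>\<^esub> y) else \<zero>\<^bsub>space W \<beta>\<^esub>) =
      (if \<beta> \<prec> \<alpha> then f \<beta> x else \<zero>\<^bsub>space W \<beta>\<^esub>) \<oplus>\<^bsub>space W \<beta>\<^esub> (if \<beta> \<prec> \<alpha> then f \<beta> y else \<zero>\<^bsub>space W \<beta>\<^esub>)"
    if "y \<in> carrier (space V \<beta>)"
    using hom_add[OF f b] x that chain_add_zero[OF W b] by simp
  show "(if \<beta> \<prec> \<alpha> then f \<beta> (c \<odot>\<^bsub>space V \<beta>\<^esub> x) else \<zero>\<^bsub>space W \<beta>\<^esub>) =
      c \<odot>\<^bsub>space W \<beta>\<^esub> (if \<beta> \<prec> \<alpha> then f \<beta> x else \<zero>\<^bsub>space W \<beta>\<^esub>)" if "c \<in> carrier (fld k \<beta>)" for c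
    using hom_smult[OF f b that] x chain_smult_zero[OF W b that] by simp
next
  fix \<beta> \<gamma> x assume le: "\<beta> \<preceq> \<gamma>" and x: "x \<in> carrier (space V \<beta>)"
  then have o: "\<beta> \<in> ON" "\<gamma> \<in> ON"
    using ord_leD by blast+
  show "(if \<gamma> \<prec> \<alpha> then f \<gamma> (tmap V \<gamma> \<beta> x) else \<zero>\<^bsub>space W \<gamma>\<^esub>) =
      tmap W \<gamma> \<beta> (if \<beta> \<prec> \<alpha> then f \<beta> x else \<zero>\<^bsub>space W \<beta>\<^esub>)"
  proof (cases "\<gamma> \<prec> \<alpha>")
    case True
    then show ?thesis
      using hom_natural[OF f le] x ord_le_less_trans[OF le] by simp
  next
    case False
    have "(if \<beta> \<prec> \<alpha> then f \<beta> x else \<zero>\<^bsub>space W \<beta>\<^esub>) \<in> carrier (space W \<beta>)"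
      using hom_closed[OF f o(1)] x chain_zero_closed[OF W o(1)] by simp
    then have "tmap W \<gamma> \<beta> (if \<beta> \<prec> \<alpha> then f \<beta> x else \<zero>\<^bsub>space W \<beta>\<^esub>) \<in> {\<zero>\<^bsub>space W \<gamma>\<^esub>}"
      using tmap_closed[OF W le] z False not_ord_less[OF o(2) a] by blast
    then show ?thesis
      using False by simp
  qed
qed

lemma truncation_hom:
  assumes V: "chain_obj k V" and W: "chain_obj k W" and f: "f \<in> chain_hom k V W"
  shows "f \<in> chain_hom k (truncation \<alpha> V) (truncation \<alpha> W)"
proof (rule chain_homI)
  fix \<beta> x y assume b: "\<beta> \<in> ON" and tx: "x \<in> carrier (space (truncation \<alpha> V) \<beta>)"
  then have x: "x \<in> carrier (space V \<beta>)"
    using truncation_carrier_subset[OF V b] by blast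
  show "f \<beta> x \<in> carrier (space (truncation \<alpha> W) \<beta>)"
    using hom_closed[OF f b x] hom_zero[OF f b V W] tx by (simp split: if_splits)
  show "f \<beta> (x \<oplus>\<^bsub>space (truncation \<alpha> V) \<beta>\<^esub> y) = f \<beta> x \<oplus>\<^bsub>space (truncation \<alpha> W) \<beta>\<^esub> f \<beta> y"
    if "y \<in> carrier (space (truncation \<alpha> V) \<beta>)"
    using hom_add[OF f b x] truncation_carrier_subset[OF V b] that by (metis subsetD truncation_simps(3))
  show "f \<beta> (c \<odot>\<^bsub>space (truncation \<alpha> V) \<beta>\<^esub> x) = c \<odot>\<^bsub>space (truncation \<alpha> W) \<beta>\<^esub> f \<beta> x"
    if "c \<in> carrier (fld k \<beta>)" for c
    using hom_smult[OF f b that x] by simp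
next
  fix \<beta> \<gamma> x assume le: "\<beta> \<preceq> \<gamma>" and "x \<in> carrier (space (truncation \<alpha> V) \<beta>)"
  then have o: "\<gamma> \<in> ON" and x: "x \<in> carrier (space V \<beta>)"
    using ord_leD truncation_carrier_subset[OF V] by blast+
  show "f \<gamma> (tmap (truncation \<alpha> V) \<gamma> \<beta> x) = tmap (truncation \<alpha> W) \<gamma> \<beta> (f \<beta> x)"
    using hom_natural[OF f le x] hom_zero[OF f o V W] by simp
qed


section \<open>Injective chains\<close>

lemma
  assumes "V \<in> grounded_chains_below k \<alpha>"
  shows below_grounded: "V \<in> grounded_chains k"
    and below_zero: "\<alpha> \<preceq> \<beta> \<Longrightarrow> carrier (space V \<beta>) = {\<zero>\<^bsub>space V \<beta>\<^esub>}"
  using assms by (auto simp: grounded_chains_below_def)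

section \<open>Comparing injectivity in the two categories\<close>

text \<open>A test object \<open>Z\<close> may be replaced by its truncation, since morphisms from
  \<open>Z\<close> to \<open>A\<close> factor through it. Cancellation there settles the degrees
  below \<alpha>; in the others \<open>A\<close> is zero.\<close>

lemma monomorphism_below:
  assumes a: "\<alpha> \<in> ON" and A: "A \<in> grounded_chains_below k \<alpha>"
    and m: "monomorphism_in k (grounded_chains_below k \<alpha>) A B m"
  shows "monomorphism_in k (grounded_chains k) A B m"
  unfolding monomorphism_in_def
proof (intro conjI ballI impI)
  show "m \<in> chain_hom k A B"
    using m by (simp add: monomorphism_in_def)
  fix Z g h
  assume Z: "Z \<in> grounded_chains k" and g: "g \<in> chain_hom k Z A" and h: "h \<in> chain_hom k Z A"
    and eq: "chain_hom_eq Z (chain_comp m g) (chain_comp m h)"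
  have Zo: "chain_obj k Z" and Ao: "chain_obj k A"
    using Z A below_grounded grounded_chains_obj by blast+
  note T = hom_from_truncation[OF Zo Ao a below_zero[OF A]]
  have "chain_hom_eq (truncation \<alpha> Z) (chain_comp m g) (chain_comp m h)"
    using eq truncation_carrier_subset[OF Zo] unfolding chain_hom_eq_def by blast
  then have eq': "chain_hom_eq (truncation \<alpha> Z) g h"
    using m truncation_below[OF Zo a] T[OF _ g] T[OF _ h] unfolding monomorphism_in_def by blast
  show "chain_hom_eq Z g h"
    unfolding chain_hom_eq_def
  proof (intro ballI)
    fix \<beta> x assume b: "\<beta> \<in> ON" and x: "x \<in> carrier (space Z \<beta>)"
    show "g \<beta> x = h \<beta> x"
    proof (cases "\<beta> \<prec> \<alpha>")
      case True
      then show ?thesis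
        using eq' b x unfolding chain_hom_eq_def by simp
    next
      case False
      then show ?thesis
        using hom_closed[OF g b x] hom_closed[OF h b x] below_zero[OF A] not_ord_less[OF b a] by auto
    qed
  qed
qed

text \<open>Every extension problem among chains vanishing from \<alpha> on is one among grounded
  chains, because its monomorphism remains one there.\<close>

lemma injective_imp_injective_below:
  assumes a: "\<alpha> \<in> ON" and V: "V \<in> grounded_chains_below k \<alpha>"
    and inj: "injective_in k (grounded_chains k) V"
  shows "injective_in k (grounded_chains_below k \<alpha>) V"
  using V inj monomorphism_below[OF a] below_grounded unfolding injective_in_def by metis

text \<open>The usual argument that a right adjoint of a functor preserving monomorphisms preserves
  injectives: truncate the extension problem, solve it, and extend the solution by zero.\<close>

lemma injective_below_imp_injective:
  assumes a: "\<alpha> \<in> ON" and V: "V \<in> grounded_chains_below k \<alpha>"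
    and inj: "injective_in k (grounded_chains_below k \<alpha>) V"
  shows "injective_in k (grounded_chains k) V"
  unfolding injective_in_def
proof (intro conjI ballI allI impI)
  show "V \<in> grounded_chains k"
    by (rule below_grounded[OF V])
  then have Vo: "chain_obj k V"
    by (rule grounded_chains_obj)
  fix A B m f
  assume A: "A \<in> grounded_chains k" and B: "B \<in> grounded_chains k"
    and m: "monomorphism_in k (grounded_chains k) A B m" and f: "f \<in> chain_hom k A V"
  have Ao: "chain_obj k A" and Bo: "chain_obj k B"
    using A B grounded_chains_obj by blast+
  have mh: "m \<in> chain_hom k A B"
    using m by (simp add: monomorphism_in_def)
  \<comment> \<open>Cancellation in one category says nothing directly about the other; the passage
    goes through injectivity in each degree, inherited by the smaller carriers.\<close>
  have "monomorphism_in k (grounded_chains_below k \<alpha>) (truncation \<alpha> A) (truncation \<alpha> B) m"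
    by (rule injective_monomorphism[OF truncation_hom[OF Ao Bo mh]])
      (metis inj_on_subset monomorphism_injective[OF m Ao] truncation_carrier_subset[OF Ao])
  moreover have "f \<in> chain_hom k (truncation \<alpha> A) V"
    by (rule hom_from_truncation[OF Ao Vo a below_zero[OF V] f])
  ultimately obtain g where g: "g \<in> chain_hom k (truncation \<alpha> B) V"
    and gm: "chain_hom_eq (truncation \<alpha> A) (chain_comp g m) f"
    using inj truncation_below[OF Ao a] truncation_below[OF Bo a] unfolding injective_in_def by blast
  let ?g = "\<lambda>\<beta> x. if \<beta> \<prec> \<alpha> then g \<beta> x else \<zero>\<^bsub>space V \<beta>\<^esub>"
  have "?g \<in> chain_hom k B V"
    by (rule hom_extend_by_zero[OF Bo Vo a below_zero[OF V] g])
  moreover have "chain_hom_eq A (chain_comp ?g m) f"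
    unfolding chain_hom_eq_def
  proof (intro ballI)
    fix \<beta> x assume b: "\<beta> \<in> ON" and x: "x \<in> carrier (space A \<beta>)"
    show "chain_comp ?g m \<beta> x = f \<beta> x"
    proof (cases "\<beta> \<prec> \<alpha>")
      case True
      then show ?thesis
        using gm b x unfolding chain_hom_eq_def chain_comp_def by simp
    next
      case False
      then show ?thesis
        using hom_closed[OF f b x] below_zero[OF V] not_ord_less[OF b a] by (simp add: chain_comp_def)
    qed
  qed
  ultimately show "\<exists>g\<in>chain_hom k B V. chain_hom_eq A (chain_comp g m) f"
    by blast
qed

text \<open>Extend the map \<open>free_chain \<beta> \<rightarrow> V\<close> given by an element of \<open>V\<^sub>\<beta>\<close> along the inclusion
  \<open>free_chain \<beta> \<subseteq> free_chain \<alpha>\<close>.\<close>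

lemma injective_tmap_surj:
  assumes inj: "injective_in k (grounded_chains k) V" and le: "\<alpha> \<preceq> \<beta>"
  shows "tmap V \<beta> \<alpha> ` carrier (space V \<alpha>) = carrier (space V \<beta>)"
proof (intro equalityI subsetI)
  have V: "chain_obj k V"
    using inj grounded_chains_obj unfolding injective_in_def by blast
  have a: "\<alpha> \<in> ON" and b: "\<beta> \<in> ON"
    using le ord_leD by auto
  show "y \<in> carrier (space V \<beta>)" if "y \<in> tmap V \<beta> \<alpha> ` carrier (space V \<alpha>)" for y
    using that tmap_closed[OF V le] by blast
  fix v assume v: "v \<in> carrier (space V \<beta>)"
  have "(\<lambda>_ c. c) \<in> chain_hom k (free_chain \<beta>) (free_chain \<alpha>)"
  proof (rule chain_homI)
    fix \<gamma> c assume g: "\<gamma> \<in> ON" and c: "c \<in> carrier (space (free_chain \<beta>) \<gamma>)"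
    have "\<alpha> \<preceq> \<gamma>" if "\<beta> \<preceq> \<gamma>"
      using le that ord_le_trans by blast
    then show "c \<in> carrier (space (free_chain \<alpha>) \<gamma>)"
      using c free_chain_carrier_subset[OF g, of \<beta>] by (auto split: if_splits)
  qed simp_all
  then have "monomorphism_in k (grounded_chains k) (free_chain \<beta>) (free_chain \<alpha>) (\<lambda>_ c. c)"
    by (rule injective_monomorphism) simp
  then obtain g where g: "g \<in> chain_hom k (free_chain \<alpha>) V"
    and eq: "chain_hom_eq (free_chain \<beta>) (chain_comp g (\<lambda>_ c. c)) (free_chain_lift V \<beta> v)"
    using inj free_chain_grounded[OF a] free_chain_grounded[OF b] free_chain_lift_hom[OF V v]
    unfolding injective_in_def by blast
  have one: "\<one>\<^bsub>fld k \<alpha>\<^esub> \<in> carrier (space (free_chain \<alpha>) \<alpha>)"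
      "\<one>\<^bsub>fld k \<beta>\<^esub> \<in> carrier (space (free_chain \<beta>) \<beta>)"
    using ord_le_refl a b cring_fld cring.cring_simprules(6) by auto
  \<comment> \<open>Evaluate \<open>g\<close> at the generators: the unit in degree \<beta> is the
    image of the unit in degree \<alpha>, so naturality exhibits a preimage of
    \<open>v\<close>.\<close>
  have "v = free_chain_lift V \<beta> v \<beta> \<one>\<^bsub>fld k \<beta>\<^esub>"
    using tmap_refl[OF V b v] ord_le_refl[OF b] module.smult_one[OF chain_module[OF V b] v]
    by (simp add: free_chain_lift_def)
  also have "\<dots> = g \<beta> \<one>\<^bsub>fld k \<beta>\<^esub>"
    using eq b one(2) by (simp add: chain_hom_eq_def chain_comp_def)
  also have "\<dots> = g \<beta> (tmap (free_chain \<alpha>) \<beta> \<alpha> \<one>\<^bsub>fld k \<alpha>\<^esub>)"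
    using emb_one[OF le] by simp
  also have "\<dots> = tmap V \<beta> \<alpha> (g \<alpha> \<one>\<^bsub>fld k \<alpha>\<^esub>)"
    by (rule hom_natural[OF g le one(1)])
  finally show "v \<in> tmap V \<beta> \<alpha> ` carrier (space V \<alpha>)"
    using hom_closed[OF g a one(1)] by blast
qed

text \<open>Beyond \<alpha> the space in degree \<gamma> is spanned by the image of the one in
  degree \<alpha>, and that image passes through the zero space in degree \<beta>.\<close>

lemma grounded_zero_above:
  assumes V: "chain_obj k V" and gr: "grounded_at k \<alpha> V"
    and le: "\<alpha> \<preceq> \<beta>" "\<beta> \<preceq> \<gamma>" and z: "carrier (space V \<beta>) = {\<zero>\<^bsub>space V \<beta>\<^esub>}"
  shows "carrier (space V \<gamma>) = {\<zero>\<^bsub>space V \<gamma>\<^esub>}"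
proof (cases "\<alpha> \<prec> \<gamma>")
  case True
  have "tmap V \<gamma> \<alpha> x = \<zero>\<^bsub>space V \<gamma>\<^esub>" if x: "x \<in> carrier (space V \<alpha>)" for x
    using tmap_trans[OF V le x] tmap_closed[OF V le(1) x] tmap_zero[OF V le(2)] z by simp
  then have "tmap V \<gamma> \<alpha> ` carrier (space V \<alpha>) \<subseteq> {\<zero>\<^bsub>space V \<gamma>\<^esub>}"
    by blast
  then show ?thesis
    using linear_span_zero[OF chain_module[OF V]] ord_leD[OF le(2)] gr True
    unfolding grounded_at_def by metis
next
  \<comment> \<open>The three ordinals coincide in this case.\<close>
  case False
  then have "\<gamma> \<preceq> \<alpha>"
    using not_ord_less le ord_leD by blast
  with le have "\<beta> = \<gamma>"
    by (metis elts_irrefl ord_le_def ON_trans)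
  then show ?thesis
    using z by simp
qed

end

section \<open>Injective chains vanish from some ordinal on\<close>

text \<open>A field has dimension one over itself, so a subfield of infinite degree is
  proper.\<close>

lemma infinite_degree_imp_not_surj:
  assumes "infinite_degree_tower k" "\<alpha> \<prec> \<beta>"
  shows "emb k \<beta> \<alpha> ` carrier (fld k \<alpha>) \<noteq> carrier (fld k \<beta>)"
proof
  interpret tower_of_fields k
    using assms(1) by unfold_locales (simp add: infinite_degree_tower_def)
  have "\<beta> \<in> ON"
    using assms(2) by (simp add: ord_less_def)
  then interpret field "fld k \<beta>"
    by (rule field_fld)
  assume "emb k \<beta> \<alpha> ` carrier (fld k \<alpha>) = carrier (fld k \<beta>)"
  moreover have "finite_dimension (carrier (fld k \<beta>)) (carrier (fld k \<beta>))"
    using finite_dimensionI[OF dimension_one[OF carrier_is_subfield]] .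
  ultimately show False
    using assms unfolding infinite_degree_tower_def by metis
qed

text \<open>One zero space at or above the grounding ordinal is enough, since groundedness
  propagates it to all later degrees.\<close>

lemma injective_imp_bounded:
  assumes k: "infinite_degree_tower k"
    and V: "injective_in k (grounded_chains k) V"
  shows "\<exists>\<alpha>\<in>ON. V \<in> grounded_chains_below k \<alpha>"
proof -
  interpret tower_of_fields k
    using k by unfold_locales (simp add: infinite_degree_tower_def)
  have Vg: "V \<in> grounded_chains k" and Vo: "chain_obj k V"
    using V grounded_chains_obj unfolding injective_in_def by blast+
  then obtain \<alpha> where a: "\<alpha> \<in> ON" and gr: "grounded_at k \<alpha> V"
    by (auto simp: grounded_chains_def)
  have "\<exists>\<beta>. \<alpha> \<preceq> \<beta> \<and> carrier (space V \<beta>) = {\<zero>\<^bsub>space V \<beta>\<^esub>}"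
  proof (rule ccontr)
    assume none: "\<nexists>\<beta>. \<alpha> \<preceq> \<beta> \<and> carrier (space V \<beta>) = {\<zero>\<^bsub>space V \<beta>\<^esub>}"
    have "\<exists>v\<in>carrier (space V \<beta>). v \<noteq> \<zero>\<^bsub>space V \<beta>\<^esub>" if "\<alpha> \<preceq> \<beta>" for \<beta>
      using none that chain_zero_closed[OF Vo, of \<beta>] ord_leD[OF that] by blast
    then obtain v where v: "\<And>\<beta>. \<alpha> \<preceq> \<beta> \<Longrightarrow> v \<beta> \<in> carrier (space V \<beta>) \<and> v \<beta> \<noteq> \<zero>\<^bsub>space V \<beta>\<^esub>"
      by metis
    \<comment> \<open>Pulling the lines \<open>k\<^sub>\<delta> v\<^sub>\<beta>\<close> with \<open>\<delta> \<le> \<beta>\<close> back to the set \<open>V\<^sub>\<alpha>\<close> gives strict chains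
      in its power set of every length.\<close>
    define S where "S \<beta> \<delta> = {x \<in> carrier (space V \<alpha>).
      \<exists>a\<in>carrier (fld k \<delta>). tmap V \<beta> \<alpha> x = emb k \<beta> \<delta> a \<odot>\<^bsub>space V \<beta>\<^esub> v \<beta>}" for \<beta> \<delta>
    have "S \<beta> \<delta> \<subset> S \<beta> \<epsilon>" if ab: "\<alpha> \<preceq> \<beta>" and de: "\<delta> \<prec> \<epsilon>" and eb: "\<epsilon> \<preceq> \<beta>" for \<beta> \<delta> \<epsilon>
    proof -
      have b: "\<beta> \<in> ON"
        using ab ord_leD by blast
      note de' = ord_lessD[OF de]
      have factor: "emb k \<beta> \<delta> a = emb k \<beta> \<epsilon> (emb k \<epsilon> \<delta> a)" if "a \<in> carrier (fld k \<delta>)" for a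
        using emb_trans[OF de' eb that] by simp
      have "S \<beta> \<delta> \<subseteq> S \<beta> \<epsilon>"
        unfolding S_def using factor emb_closed[OF de'] by fastforce
      \<comment> \<open>The witness for strictness: a scalar of \<open>fld k \<epsilon>\<close> that
        does not come from \<open>fld k \<delta>\<close>. Surjectivity of the transition map pulls
        the multiple of \<open>v \<beta>\<close> by it back to degree \<alpha>.\<close>
      moreover obtain c where c: "c \<in> carrier (fld k \<epsilon>)" "c \<notin> emb k \<epsilon> \<delta> ` carrier (fld k \<delta>)"
        using infinite_degree_imp_not_surj[OF k de] emb_closed[OF de'] by blast
      have "emb k \<beta> \<epsilon> c \<odot>\<^bsub>space V \<beta>\<^esub> v \<beta> \<in> carrier (space V \<beta>)"
        using module.smult_closed[OF chain_module[OF Vo b]] emb_closed[OF eb c(1)] v[OF ab] by blast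
      then obtain x where x: "x \<in> carrier (space V \<alpha>)"
          "tmap V \<beta> \<alpha> x = emb k \<beta> \<epsilon> c \<odot>\<^bsub>space V \<beta>\<^esub> v \<beta>"
        using injective_tmap_surj[OF V ab] by (metis imageE)
      have "x \<notin> S \<beta> \<delta>"
      proof
        assume "x \<in> S \<beta> \<delta>"
        then obtain d where d: "d \<in> carrier (fld k \<delta>)"
            "emb k \<beta> \<epsilon> c \<odot>\<^bsub>space V \<beta>\<^esub> v \<beta> = emb k \<beta> \<epsilon> (emb k \<epsilon> \<delta> d) \<odot>\<^bsub>space V \<beta>\<^esub> v \<beta>"
          unfolding S_def using x factor by auto
        \<comment> \<open>Cancel the nonzero vector \<open>v \<beta>\<close> in degree \<beta>;
          injectivity of the embedding then brings the equation of scalars down to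
          \<open>fld k \<epsilon>\<close>.\<close>
        have "emb k \<beta> \<epsilon> c = emb k \<beta> \<epsilon> (emb k \<epsilon> \<delta> d)"
          using smult_right_cancel[OF field_fld[OF b] chain_module[OF Vo b] _ _ _ _ d(2)]
            emb_closed[OF eb] c(1) emb_closed[OF de' d(1)] v[OF ab] by blast
        then have "c = emb k \<epsilon> \<delta> d"
          using inj_onD[OF emb_inj[OF eb]] c(1) emb_closed[OF de' d(1)] by blast
        then show False
          using c(2) d(1) by blast
      qed
      moreover have "x \<in> S \<beta> \<epsilon>"
        unfolding S_def using x c(1) by blast
      ultimately show ?thesis
        by blast
    qed
    moreover have "S \<beta> \<delta> \<subseteq> carrier (space V \<alpha>)" for \<beta> \<delta>
      unfolding S_def by blast
    ultimately show False
      using no_arbitrarily_long_strict_chains[OF chain_set[OF Vo a] a, of S] by blast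
  qed
  then obtain \<beta> where le: "\<alpha> \<preceq> \<beta>" and z: "carrier (space V \<beta>) = {\<zero>\<^bsub>space V \<beta>\<^esub>}"
    by blast
  have "V \<in> grounded_chains_below k \<beta>"
    using Vg grounded_zero_above[OF Vo gr le _ z] by (simp add: grounded_chains_below_def)
  then show ?thesis
    using le ord_leD by blast
qed

theorem theorem1p14:
  fixes k :: "'v::zfc_universe tower" and V :: "'v chain"
  assumes "infinite_degree_tower k"
    and "V \<in> grounded_chains k"
  shows "injective_in k (grounded_chains k) V \<longleftrightarrow>
    (\<exists>\<alpha>\<in>ON. V \<in> grounded_chains_below k \<alpha> \<and> injective_in k (grounded_chains_below k \<alpha>) V)"
proof -
  interpret tower_of_fields k
    using assms(1) by unfold_locales (simp add: infinite_degree_tower_def)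
  show ?thesis
    using injective_imp_bounded[OF assms(1)] injective_imp_injective_below
      injective_below_imp_injective by blast
qed

end
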